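(* Let $q$ be a prime power and $V$ an $n$-dimensional vector space over the finite field $\mathbb{F}_q$. Let $n$, $r$, $s$ and $t$ be positive integers, and let $R$, $S$ be subsets of $[n]$ with $t\leq\min (R\cup S)$, $r=\max R$, $s=\max S$ and $r+s-t<n$. If $\mathcal{A}\subseteq{V\brack R}$ and $\mathcal{B}\subseteq{V\brack S}$ are non-empty cross $t$-intersecting, then $$|\mathcal{A}|+|\mathcal{B}|\leq\max\left\{1+\sum_{i\in S}\sum_{j=t}^{i}q^{(r-j)(i-j)}{r\brack j}{n-r\brack i-j},\ 1+\sum_{i\in R}\sum_{j=t}^{i}q^{(s-j)(i-j)}{s\brack j}{n-s\brack i-j}\right\}.\qquad ( * )$$ Moreover, the following hold. (1) If $R=S$, then equality holds in $( * )$ if and only if one of the following holds: (i) $\mathcal{A}=\{A\}$ and $\mathcal{B}=\{B\in{V\brack S}:\dim(B\cap A)\geq t\}$ for some $A\in{V\brack r}$; (ii) $\mathcal{B}=\{B\}$ and $\mathcal{A}=\{A\in{V\brack R}:\dim(A\cap B)\geq t\}$ for some $B\in{V\brack s}$. (2) If $R\neq S$ and $s^2+r^2+sr\leq n$, then equality holds in $( * )$ if and only if one of the following holds: (i) $\max (R\bigtriangleup S)\in S$, and $\mathcal{A}=\{A\}$ and $\mathcal{B}=\{B\in{V\brack S}:\dim(B\cap A)\geq t\}$ for some $A\in{V\brack r}$; (ii) $\max (R\bigtriangleup S)\in R$, and $\mathcal{B}=\{B\}$ and $\mathcal{A}=\{A\in{V\brack R}:\dim(A\cap B)\geq t\}$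 for some $B\in{V\brack s}$.
   Context: $[n]=\{1,2,\ldots,n\}$. ${V\brack k}$ is the family of all $k$-dimensional subspaces of $V$; for $M\subseteq[n]$, ${V\brack M}=\bigcup_{m\in M}{V\brack m}$. For non-negative integers $m,k$, ${m\brack k}=\prod_{i=0}^{k-1}\frac{q^{m-i}-1}{q^{k-i}-1}$ is the Gaussian binomial coefficient (equal to $1$ if $k=0$ and to $0$ if $k>m$). Two families $\mathcal{A}\subseteq{V\brack R}$ and $\mathcal{B}\subseteq{V\brack S}$ are non-empty cross $t$-intersecting if both are non-empty and $\dim(A\cap B)\geq t$ for all $A\in\mathcal{A}$ and $B\in\mathcal{B}$. $R\bigtriangleup S$ denotes the symmetric difference. Since $r=\max R$ and $s=\max S$, the sets $R,S$ are non-empty. *)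

theory Defs
  imports Complex_Main "HOL-Library.Cardinality"
begin

text \<open>
  Subtraction on \<open>nat\<close> truncates, so for \<open>m < k\<close> the factor at \<open>i = m\<close> is
  \<open>0\<close> and the product vanishes. For \<open>q > 1\<close> all denominators are nonzero.
\<close>

definition gauss_binomial :: "nat \<Rightarrow> nat \<Rightarrow> nat \<Rightarrow> real" where
  "gauss_binomial q m k =
     (\<Prod>i<k. (real q ^ (m - i) - 1) / (real q ^ (k - i) - 1))"

text \<open>
  The number of subspaces of an \<open>n\<close>-dimensional space over a field with \<open>q\<close> elements
  that have dimension in \<open>M\<close> and meet a fixed \<open>k\<close>-dimensional subspace in dimension
  at least \<open>t\<close>; \<open>j\<close> is the dimension of the intersection. The exponent \<open>k - j\<close>
  truncates only for \<open>j > k\<close>, where \<open>gauss_binomial q k j = 0\<close>.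
\<close>

definition meet_sum :: "nat \<Rightarrow> nat \<Rightarrow> nat \<Rightarrow> nat \<Rightarrow> nat set \<Rightarrow> real" where
  "meet_sum q n t k M =
     (\<Sum>i\<in>M. \<Sum>j=t..i. real q ^ ((k - j) * (i - j)) *
        gauss_binomial q k j * gauss_binomial q (n - k) (i - j))"

definition subspaces_of_dim ::
    "('k::field \<Rightarrow> 'v::ab_group_add \<Rightarrow> 'v) \<Rightarrow> nat \<Rightarrow> 'v set set" where
  "subspaces_of_dim scale k =
     {W. module.subspace scale W \<and> vector_space.dim scale W = k}"

definition subspaces_of_dims ::
    "('k::field \<Rightarrow> 'v::ab_group_add \<Rightarrow> 'v) \<Rightarrow> nat set \<Rightarrow> 'v set set" where
  "subspaces_of_dims scale M = (\<Union>m\<in>M. subspaces_of_dim scale m)"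

definition nonempty_cross_intersecting ::
    "('k::field \<Rightarrow> 'v::ab_group_add \<Rightarrow> 'v) \<Rightarrow> nat \<Rightarrow> 'v set set \<Rightarrow> 'v set set \<Rightarrow> bool" where
  "nonempty_cross_intersecting scale t \<A> \<B> \<longleftrightarrow>
     \<A> \<noteq> {} \<and> \<B> \<noteq> {} \<and> (\<forall>A\<in>\<A>. \<forall>B\<in>\<B>. t \<le> vector_space.dim scale (A \<inter> B))"

end

theory Submission
  imports Defs
begin

text \<open>
  If \<open>(\<A>, \<B>)\<close> and \<open>(\<A>', \<B>')\<close> are cross \<open>t\<close>-intersecting, then so are
  \<open>(\<A> \<inter> \<A>', \<B> \<union> \<B>')\<close> and \<open>(\<A> \<union> \<A>', \<B> \<inter> \<B>')\<close> if no family is empty,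
  and the total sizes add up to the same number. Let \<open>(\<A>, \<B>)\<close> be of maximal total size with \<open>|\<A>| \<le> |\<B>|\<close>, and let \<open>g\<close> be a linear bijection such that
  \<open>\<A> \<inter> g\<A>\<close> is non-empty. Then \<open>\<B> \<inter> g\<B>\<close> is non-empty too, so \<open>(\<A> \<inter> g\<A>, \<B> \<union> g\<B>)\<close> is again
  maximal. If \<open>g\<A> = \<A>\<close> for all such \<open>g\<close>, then \<open>\<A>\<close> has a single member, necessarily of dimension
  \<open>r\<close>. Otherwise, by induction on \<open>|\<A>|\<close>, some \<open>\<A> \<inter> g\<A>\<close> is a singleton \<open>{A}\<close> and \<open>\<B> \<union> g\<B>\<close>
  consists of all \<open>B\<close> with \<open>dim (B \<inter> A) \<ge> t\<close>. This is impossible: as two proper subspaces never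
  cover a space, some \<open>B\<close> meets \<open>A\<close> in dimension at least \<open>t\<close> but meets both a given member of
  \<open>\<A> - {A}\<close> and a given member of \<open>g\<A> - {A}\<close> in dimension less than \<open>t\<close>. So the maximal pairs are
  stars. Which star is larger when \<open>R \<noteq> S\<close> follows by double counting: consecutive layers grow by
  a factor of at least \<open>2\<close> up to half the dimension.
\<close>

section \<open>Fibre counting and doubling sequences\<close>

lemma card_eq_sum_fibers:
  assumes "finite X" "finite I" "f ` X \<subseteq> I"
  shows "card X = (\<Sum>y\<in>I. card {x \<in> X. f x = y})"
  using sum.group[OF assms, of "\<lambda>_. 1 :: nat"] by simp

text \<open>If the values before \<open>b\<close> sum to less than \<open>f b\<close>, adding
  \<open>f b\<close> stays below \<open>2 * f b\<close>. This later shows that one layer of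
  subspaces outweighs all layers below it.\<close>

lemma sum_less_of_doubling:
  fixes f :: "nat \<Rightarrow> nat"
  assumes "0 < f a" "a \<le> b" "\<And>i. a \<le> i \<Longrightarrow> i < b \<Longrightarrow> 2 * f i \<le> f (Suc i)"
  shows "sum f {a..<b} < f b"
  using assms(2,3)
proof (induction b rule: dec_induct)
  case (step b)
  then have "sum f {a..<b} < f b" by simp
  then show ?case using step by (fastforce simp: sum.atLeastLessThan_Suc)
qed (use assms(1) in simp)

section \<open>Vector spaces over finite fields\<close>

locale finite_field_space = finite_dimensional_vector_space scale Basis
  for scale :: "'k::{field,finite} \<Rightarrow> 'v::ab_group_add \<Rightarrow> 'v" (infixr \<open>*s\<close> 75)
    and Basis :: "'v set"
begin

text \<open>Each vector of the span is \<open>c *s v + w\<close> for exactly one pair of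
  \<open>c\<close> and \<open>w\<close> in \<open>W\<close>: two different scalars would put
  \<open>v\<close> into \<open>W\<close>.\<close>

lemma card_span_insert:
  assumes W: "subspace W" and v: "v \<notin> W"
  shows "card (span (insert v W)) = CARD('k) * card W"
proof -
  have sp: "span W = W" using W by simp
  have "bij_betw (\<lambda>(c, w). c *s v + w) (UNIV \<times> W) (span (insert v W))"
    unfolding bij_betw_def
  proof
    show "inj_on (\<lambda>(c, w). c *s v + w) (UNIV \<times> W)"
    proof (rule inj_onI, clarsimp)
      fix c w d u assume w: "w \<in> W" "u \<in> W" and eq: "c *s v + w = d *s v + u"
      then have "(c - d) *s v = u - w" by (simp add: scale_left_diff_distrib algebra_simps)
      then have *: "(c - d) *s v \<in> W" using w W subspace_diff by metis
      have "c = d"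
      proof (rule ccontr)
        assume "c \<noteq> d"
        then have "v = inverse (c - d) *s ((c - d) *s v)" by simp
        then show False using * v W subspace_scale by metis
      qed
      then show "c = d \<and> w = u" using eq by simp
    qed
    show "(\<lambda>(c, w). c *s v + w) ` (UNIV \<times> W) = span (insert v W)"
    proof (intro equalityI subsetI)
      fix x assume "x \<in> (\<lambda>(c, w). c *s v + w) ` (UNIV \<times> W)"
      then obtain c w where "w \<in> W" "x = c *s v + w" by auto
      then show "x \<in> span (insert v W)"
        unfolding span_insert sp by (auto intro!: exI[of _ c])
    next
      fix x assume "x \<in> span (insert v W)"
      then obtain c where "x - c *s v \<in> W" unfolding span_insert sp by auto
      then show "x \<in> (\<lambda>(c, w). c *s v + w) ` (UNIV \<times> W)"
        by (intro image_eqI[of _ _ "(c, x - c *s v)"]) auto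
    qed
  qed
  then show ?thesis by (metis bij_betw_same_card card_cartesian_product)
qed

lemma card_subspace:
  assumes "subspace W"
  shows "card W = CARD('k) ^ dim W"
proof -
  obtain B where B: "B \<subseteq> W" "independent B" "W \<subseteq> span B" "card B = dim W"
    using basis_exists by metis
  have W: "W = span B" using B assms span_subspace by metis
  have "finite B" using B finiteI_independent by metis
  then have "independent B \<Longrightarrow> card (span B) = CARD('k) ^ card B"
  proof (induction B)
    case (insert x F)
    then have "x \<notin> span F" "independent F" by (simp_all add: independent_insert)
    moreover have "span (insert x F) = span (insert x (span F))"
    proof (rule span_unique[OF _ subspace_span])
      have "x \<in> span (insert x (span F))" by (rule span_base) simp
      moreover have "F \<subseteq> span (insert x (span F))"
        using span_superset[of F] span_superset[of "insert x (span F)"] by blast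
      ultimately show "insert x F \<subseteq> span (insert x (span F))" by simp
    next
      fix T assume T: "insert x F \<subseteq> T" "subspace T"
      then show "span (insert x (span F)) \<subseteq> T"
        using span_minimal[of F T] by (intro span_minimal) auto
    qed
    ultimately show ?case using insert by (simp add: card_span_insert)
  qed simp
  then show ?thesis using B W by simp
qed

lemma finite_vectors [simp]: "finite (X :: 'v set)"
proof -
  have "card (UNIV :: 'v set) > 0"
    using card_subspace[OF subspace_UNIV] by simp
  then show ?thesis by (metis card_ge_0_finite finite_subset subset_UNIV)
qed

lemma finite_families [simp]: "finite (\<A> :: 'v set set)"
  proof (rule finite_subset)
  show "\<A> \<subseteq> Pow UNIV" by simp
  show "finite (Pow (UNIV :: 'v set))" unfolding finite_Pow_iff by (rule finite_vectors)
qed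

lemma card_scalars_ge_2: "2 \<le> CARD('k)"
proof -
  have "card {0, 1 :: 'k} \<le> CARD('k)" by (rule card_mono) auto
  then show ?thesis by simp
qed

lemma span_of_subspace: "subspace W \<Longrightarrow> span W = W"
  by simp

section \<open>Dimensions, intersections and extensions of subspaces\<close>

lemma dim_span_insert:
  assumes "subspace W" "v \<notin> W"
  shows "dim (span (insert v W)) = Suc (dim W)"
  using assms by (simp add: dim_insert span_of_subspace)

lemma dim_span_Un_Int:
  assumes "subspace A" "subspace B"
  shows "dim (span (A \<union> B)) + dim (A \<inter> B) = dim A + dim B"
proof -
  have "span A = A" "span B = B" using assms by simp_all
  then show ?thesis using dim_sums_Int[OF assms] by (simp only: span_Un)
qed

lemma subspace_ne_dim_less:
  assumes "subspace S" "subspace T" "S \<subseteq> T" "S \<noteq> T"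
  shows "dim S < dim T"
  using assms subspace_dim_equal not_less by metis

text \<open>If a vector of \<open>A\<close> is \<open>c *s v\<close> plus a vector of
  \<open>B\<close> with \<open>c\<close> nonzero, then \<open>v\<close> lies in
  \<open>span (B \<union> A)\<close>.\<close>

lemma span_insert_Int:
  assumes B: "subspace B" and A: "subspace A" and v: "v \<notin> span (B \<union> A)"
  shows "span (insert v B) \<inter> A = B \<inter> A"
proof
  show "span (insert v B) \<inter> A \<subseteq> B \<inter> A"
  proof
    fix x assume x: "x \<in> span (insert v B) \<inter> A"
    then obtain c where c: "x - c *s v \<in> B"
      using B by (auto simp: span_insert span_of_subspace)
    have "c = 0"
    proof (rule ccontr)
      assume c0: "c \<noteq> 0"
      have "x - (x - c *s v) \<in> span (B \<union> A)"
        using x c by (intro span_diff span_base) auto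
      then have "inverse c *s (c *s v) \<in> span (B \<union> A)"
        using span_scale[of "c *s v"] by (simp del: scale_scale)
      moreover have "inverse c *s (c *s v) = v" using c0 by simp
      ultimately show False using v by simp
    qed
    then show "x \<in> B \<inter> A" using c x by simp
  qed
  show "B \<inter> A \<subseteq> span (insert v B) \<inter> A" by (auto intro: span_base)
qed

text \<open>With \<open>x\<close> in \<open>C\<close> outside \<open>A\<close> and \<open>y\<close>
  in \<open>C\<close> outside \<open>B\<close>, one of \<open>x\<close>, \<open>y\<close>,
  \<open>x + y\<close> avoids both.\<close>

lemma proper_subspaces_not_cover:
  assumes A: "subspace A" and B: "subspace B" and C: "subspace C"
    and nA: "\<not> C \<subseteq> A" and nB: "\<not> C \<subseteq> B"
  obtains v where "v \<in> C" "v \<notin> A" "v \<notin> B"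
proof -
  obtain x y where x: "x \<in> C" "x \<notin> A" and y: "y \<in> C" "y \<notin> B" using nA nB by blast
  show ?thesis
  proof (cases "x \<in> B \<and> y \<in> A")
    case True
    have "x + y \<in> C" using x y C subspace_add by blast
    moreover have "x + y \<notin> A"
      using subspace_diff[OF A, of "x + y" y] True x by auto
    moreover have "x + y \<notin> B"
      using subspace_diff[OF B, of "x + y" x] True y by auto
    ultimately show ?thesis using that by blast
  next
    case False
    then show ?thesis using x y that by blast
  qed
qed

lemma superspace_exists:
  assumes "subspace A" "A \<subseteq> C" "subspace C" "dim A \<le> m" "m \<le> dim C"
  obtains B where "subspace B" "A \<subseteq> B" "B \<subseteq> C" "dim B = m"
proof -
  have "\<exists>B. subspace B \<and> A \<subseteq> B \<and> B \<subseteq> C \<and> dim B = m"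
    using assms(4,5)
  proof (induction m rule: dec_induct)
    case base
    then show ?case using assms by blast
  next
    case (step m)
    then obtain B where B: "subspace B" "A \<subseteq> B" "B \<subseteq> C" "dim B = m" by auto
    obtain v where v: "v \<in> C" "v \<notin> B"
      using B step.prems by (metis Suc_n_not_le_n subsetI subset_antisym)
    show ?case
    proof (intro exI conjI)
      show "A \<subseteq> span (insert v B)" using B span_superset by blast
      show "span (insert v B) \<subseteq> C" using v B assms by (intro span_minimal) auto
    qed (use B v dim_span_insert in auto)
  qed
  then show ?thesis using that by blast
qed

text \<open>The map is the shear \<open>z + f z *s (y - x)\<close> for a linear functional
  \<open>f\<close> that vanishes on \<open>U\<close>, with \<open>f x = 1\<close> and
  \<open>f y\<close> nonzero.\<close>

lemma shear_exists:
  assumes U: "subspace U" and x: "x \<notin> U" and y: "y \<notin> U"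
  obtains g where "Vector_Spaces.linear scale scale g" "inj g" "\<And>u. u \<in> U \<Longrightarrow> g u = u" "g x = y"
    "\<And>z. g z - z \<in> span {y - x}"
proof -
  obtain D where D: "D \<subseteq> U" "independent D" "U \<subseteq> span D"
    using basis_exists by metis
  have sD: "span D = U" using D U span_subspace by metis
  have xD: "independent (insert x D)" using D x sD independent_insertI by metis
  \<comment> \<open>\<open>f\<close> will be the coordinate at \<open>x\<close> in the basis
    \<open>B\<close>, so this coordinate of \<open>y\<close> must be nonzero. For \<open>y\<close>
    in the span of \<open>x\<close> and \<open>U\<close> this follows from
    \<open>y \<notin> U\<close>; otherwise \<open>y - x\<close> is put into the basis, which makes
    the coordinate 1.\<close>
  obtain B where B: "insert x D \<subseteq> B" "independent B" "span B = UNIV"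
    and y0: "representation B y x \<noteq> 0"
  proof (cases "y \<in> span (insert x D)")
    case True
    obtain B where B: "insert x D \<subseteq> B" "independent B" "UNIV \<subseteq> span B"
      using maximal_independent_subset_extend[OF subset_UNIV xD] by metis
    obtain c where c: "y - c *s x \<in> span D" using True span_insert by auto
    have "x \<notin> D" using x D by auto
    then have "representation D (y - c *s x) x = 0"
      using representation_ne_zero by metis
    then have "representation B (y - c *s x) x = 0"
      using representation_extend[OF B(2) c] B by auto
    moreover have "y \<in> span B" "x \<in> span B" "c *s x \<in> span B" using B by auto
    ultimately have "representation B y x = c"
      using B by (simp add: representation_diff representation_scale representation_basis)
    moreover have "c \<noteq> 0" using c y sD by auto
    ultimately show ?thesis using that[of B] B by auto
  next
    case False
    have "y - x \<notin> span (insert x D)"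
      using False span_add[of "y - x" "insert x D" x] span_base[of x "insert x D"] by auto
    then have "independent (insert (y - x) (insert x D))"
      using independent_insertI xD by metis
    then obtain B where B: "insert (y - x) (insert x D) \<subseteq> B" "independent B" "UNIV \<subseteq> span B"
      using maximal_independent_subset_extend[OF subset_UNIV] by metis
    have "y - x \<noteq> x" using \<open>y - x \<notin> span (insert x D)\<close> span_base by fastforce
    moreover have "representation B y = representation B ((y - x) + x)" by simp
    ultimately have "representation B y x = 1"
      using B by (subst (asm) representation_add) (auto simp: representation_basis)
    then show ?thesis using that[of B] B by auto
  qed
  define f where "f z = representation B z x" for z
  have fadd: "f (a + b) = f a + f b" for a b
    using B by (simp add: f_def representation_add)
  have fdiff: "f (a - b) = f a - f b" for a b
    using B by (simp add: f_def representation_diff)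
  have fscale: "f (c *s a) = c * f a" for c a
    using B by (simp add: f_def representation_scale)
  have fx: "f x = 1" using B by (simp add: f_def representation_basis)
  have fU: "f u = 0" if "u \<in> U" for u
  proof -
    have "u \<in> span D" using that sD by simp
    moreover have "x \<notin> D" using x D by auto
    ultimately show ?thesis
      using representation_extend[OF B(2), of u D] representation_ne_zero[of D u x] B
      by (auto simp: f_def)
  qed
  define g where "g z = z + f z *s (y - x)" for z
  have lin: "Vector_Spaces.linear scale scale g"
    unfolding Vector_Spaces.linear_iff
    by (simp add: vector_space_axioms g_def fadd fscale scale_left_distrib scale_right_distrib)
  have g0: "z = 0" if "g z = 0" for z
  proof -
    \<comment> \<open>\<open>g\<close> multiplies the value of \<open>f\<close> by
      \<open>f y\<close>, so \<open>g z = 0\<close> gives \<open>f z = 0\<close>, and then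
      \<open>g z\<close> is \<open>z\<close> itself.\<close>
    have "f (g z) = f z + f z * (f y - 1)"
      by (simp add: g_def fadd fscale fdiff fx)
    also have "\<dots> = f z * f y" by (simp add: algebra_simps)
    finally have "f z * f y = 0" using that by (simp add: f_def representation_zero)
    then have "f z = 0" using y0 by (simp add: f_def)
    then show ?thesis using that by (simp add: g_def)
  qed
  have "inj g"
  proof (rule injI)
    fix a b assume "g a = g b"
    moreover have "g (a - b) = g a - g b"
      using fdiff by (simp add: g_def scale_left_diff_distrib)
    ultimately have "g (a - b) = 0" by simp
    then show "a = b" using g0 by force
  qed
  then show ?thesis
    using that[of g] lin fU fx by (auto simp: g_def span_base span_scale)
qed

section \<open>Cross-intersecting pairs of maximal size\<close>

definition cross_pair :: "nat \<Rightarrow> nat set \<Rightarrow> nat set \<Rightarrow> 'v set set \<Rightarrow> 'v set set \<Rightarrow> bool" where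
  "cross_pair t R S \<A> \<B> \<longleftrightarrow> \<A> \<subseteq> subspaces_of_dims scale R \<and>
     \<B> \<subseteq> subspaces_of_dims scale S \<and> nonempty_cross_intersecting scale t \<A> \<B>"

definition optimal :: "nat \<Rightarrow> nat set \<Rightarrow> nat set \<Rightarrow> 'v set set \<Rightarrow> 'v set set \<Rightarrow> bool" where
  "optimal t R S \<A> \<B> \<longleftrightarrow> cross_pair t R S \<A> \<B> \<and>
     (\<forall>\<A>' \<B>'. cross_pair t R S \<A>' \<B>' \<longrightarrow> card \<A>' + card \<B>' \<le> card \<A> + card \<B>)"

definition meeting :: "nat \<Rightarrow> nat set \<Rightarrow> 'v set \<Rightarrow> 'v set set" where
  "meeting t S A = {B \<in> subspaces_of_dims scale S. t \<le> dim (B \<inter> A)}"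

lemma mem_subspaces_of_dims:
  "A \<in> subspaces_of_dims scale R \<longleftrightarrow> subspace A \<and> dim A \<in> R"
  by (auto simp: subspaces_of_dims_def subspaces_of_dim_def)

lemma cross_pair_sym: "cross_pair t R S \<A> \<B> \<longleftrightarrow> cross_pair t S R \<B> \<A>"
  unfolding cross_pair_def nonempty_cross_intersecting_def by (metis Int_commute)

lemma optimal_sym: "optimal t R S \<A> \<B> \<longleftrightarrow> optimal t S R \<B> \<A>"
  unfolding optimal_def cross_pair_sym[of t S R] by (metis add.commute)

lemma cross_pairD:
  assumes "cross_pair t R S \<A> \<B>" "A \<in> \<A>" "B \<in> \<B>"
  shows "subspace A" "dim A \<in> R" "subspace B" "dim B \<in> S" "t \<le> dim (A \<inter> B)"
  using assms by (auto simp: cross_pair_def nonempty_cross_intersecting_def mem_subspaces_of_dims subset_iff)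

section \<open>Operations on cross-intersecting pairs\<close>

text \<open>A member of the union comes from one of the two pairs, while a member of the
  intersection belongs to both.\<close>

lemma cross_pair_Un_Int:
  assumes P: "cross_pair t R S \<A> \<B>" and Q: "cross_pair t R S \<A>' \<B>'" and "\<B> \<inter> \<B>' \<noteq> {}"
  shows "cross_pair t R S (\<A> \<union> \<A>') (\<B> \<inter> \<B>')"
  unfolding cross_pair_def nonempty_cross_intersecting_def
proof (intro conjI ballI)
  show "\<A> \<union> \<A>' \<subseteq> subspaces_of_dims scale R" "\<B> \<inter> \<B>' \<subseteq> subspaces_of_dims scale S"
    "\<A> \<union> \<A>' \<noteq> {}"
    using P Q by (auto simp: cross_pair_def nonempty_cross_intersecting_def)
  show "t \<le> dim (A \<inter> B)" if "A \<in> \<A> \<union> \<A>'" "B \<in> \<B> \<inter> \<B>'" for A B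
    using that cross_pairD(5)[OF P] cross_pairD(5)[OF Q] by blast
qed (fact assms(3))

lemma linear_inj_image:
  assumes "Vector_Spaces.linear scale scale g" "inj g" "subspace A"
  shows "subspace (g ` A)" "dim (g ` A) = dim A"
proof -
  interpret P: finite_dimensional_vector_space_pair_1 scale Basis scale by unfold_locales
  interpret g: Vector_Spaces.linear scale scale g by fact
  show "subspace (g ` A)" using assms g.subspace_image by blast
  show "dim (g ` A) = dim A"
    using assms inj_on_subset by (intro P.dim_image_eq) blast+
qed

lemma cross_pair_image:
  assumes g: "Vector_Spaces.linear scale scale g" "inj g" and P: "cross_pair t R S \<A> \<B>"
  shows "cross_pair t R S ((`) g ` \<A>) ((`) g ` \<B>)"
  unfolding cross_pair_def nonempty_cross_intersecting_def
proof (intro conjI ballI)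
  have ne: "\<A> \<noteq> {}" "\<B> \<noteq> {}"
    using P by (auto simp: cross_pair_def nonempty_cross_intersecting_def)
  then show "(`) g ` \<A> \<noteq> {}" "(`) g ` \<B> \<noteq> {}" by auto
  show "(`) g ` \<A> \<subseteq> subspaces_of_dims scale R" "(`) g ` \<B> \<subseteq> subspaces_of_dims scale S"
    using P linear_inj_image[OF g] by (auto simp: cross_pair_def mem_subspaces_of_dims subset_iff)
  fix A' B' assume "A' \<in> (`) g ` \<A>" "B' \<in> (`) g ` \<B>"
  then obtain A B where AB: "A \<in> \<A>" "B \<in> \<B>" "A' = g ` A" "B' = g ` B" by auto
  have "dim (A' \<inter> B') = dim (A \<inter> B)"
    using linear_inj_image[OF g, of "A \<inter> B"] cross_pairD[OF P AB(1,2)] AB g(2)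
    by (simp add: image_Int subspace_inter)
  then show "t \<le> dim (A' \<inter> B')" using cross_pairD[OF P AB(1,2)] by simp
qed

text \<open>The pairs (intersection, union) and (union, intersection) together have twice the
  optimal size, and neither exceeds the optimum, so both attain it.\<close>

lemma optimal_merge:
  assumes opt: "optimal t R S \<A> \<B>" and le: "card \<A> \<le> card \<B>"
    and g: "Vector_Spaces.linear scale scale g" "inj g" and ne: "\<A> \<inter> (`) g ` \<A> \<noteq> {}"
  shows "optimal t R S (\<A> \<inter> (`) g ` \<A>) (\<B> \<union> (`) g ` \<B>)"
proof -
  let ?A = "(`) g ` \<A>" and ?B = "(`) g ` \<B>"
  have P: "cross_pair t R S \<A> \<B>" using opt by (simp add: optimal_def)
  have Q: "cross_pair t R S ?A ?B" by (rule cross_pair_image[OF g P])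
  have I: "cross_pair t R S (\<A> \<inter> ?A) (\<B> \<union> ?B)"
    using cross_pair_Un_Int[of t S R \<B> \<A> ?B ?A] P Q ne by (simp add: cross_pair_sym)
  have inj: "inj ((`) g)" using g(2) by (simp add: inj_def inj_image_eq_iff)
  have cA: "card ?A = card \<A>" and cB: "card ?B = card \<B>"
    using card_image[OF inj_on_subset[OF inj subset_UNIV]] by blast+
  have sumA: "card \<A> + card \<A> = card (\<A> \<union> ?A) + card (\<A> \<inter> ?A)"
    using card_Un_Int[of \<A> ?A] cA by simp
  have sumB: "card \<B> + card \<B> = card (\<B> \<union> ?B) + card (\<B> \<inter> ?B)"
    using card_Un_Int[of \<B> ?B] cB by simp
  have leI: "card (\<A> \<inter> ?A) + card (\<B> \<union> ?B) \<le> card \<A> + card \<B>"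
    using opt I by (simp add: optimal_def)
  have pos: "card (\<A> \<inter> ?A) > 0" using ne by (simp add: card_gt_0_iff)
  \<comment> \<open>Otherwise \<open>\<B> \<union> ?B\<close> would have twice the size of
    \<open>\<B>\<close>, which already reaches the optimum by \<open>le\<close>; the non-empty
    \<open>\<A> \<inter> ?A\<close> would exceed it.\<close>
  have "\<B> \<inter> ?B \<noteq> {}"
  proof
    assume "\<B> \<inter> ?B = {}"
    then have "card \<B> + card \<B> = card (\<B> \<union> ?B)" using sumB by simp
    then show False using leI pos le by linarith
  qed
  then have "cross_pair t R S (\<A> \<union> ?A) (\<B> \<inter> ?B)"
    by (rule cross_pair_Un_Int[OF P Q])
  then have "card (\<A> \<union> ?A) + card (\<B> \<inter> ?B) \<le> card \<A> + card \<B>"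
    using opt by (simp add: optimal_def)
  then have "card (\<A> \<inter> ?A) + card (\<B> \<union> ?B) = card \<A> + card \<B>"
    using sumA sumB leI by linarith
  then show ?thesis using I opt by (simp add: optimal_def)
qed

lemma optimal_exists:
  assumes "cross_pair t R S \<A> \<B>"
  shows "\<exists>\<A>' \<B>'. optimal t R S \<A>' \<B>'"
proof -
  have le: "card \<C> \<le> card (UNIV :: 'v set set)" for \<C> :: "'v set set"
    by (rule card_mono) simp_all
  let ?P = "\<lambda>p. cross_pair t R S (fst p) (snd p)" and ?f = "\<lambda>p. card (fst p) + card (snd p)"
  have "\<exists>p. ?P p \<and> (\<forall>p'. ?P p' \<longrightarrow> ?f p' \<le> ?f p)"
  proof (rule ex_has_greatest_nat)
    show "?P (\<A>, \<B>)" using assms by simp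
    show "\<forall>p. ?P p \<longrightarrow> ?f p < Suc (card (UNIV :: 'v set set) + card (UNIV :: 'v set set))"
      using add_mono[OF le le] by (simp add: less_Suc_eq_le)
  qed
  then show ?thesis unfolding optimal_def by fastforce
qed

text \<open>By \<open>block\<close>, \<open>\<A>\<close> is a block for the injective linear maps.
  If it had two members, a shear preserving \<open>\<A>\<close> would decrease the least dimension
  in which members of \<open>\<A>\<close> meet a fixed \<open>B\<close>.\<close>

lemma cross_pair_block_singleton:
  assumes P: "cross_pair t R S \<A> \<B>" and t: "t > 0"
    and small: "\<And>i j. i \<in> R \<Longrightarrow> j \<in> S \<Longrightarrow> i + j < dim UNIV + t"
    and block: "\<And>g. \<lbrakk>Vector_Spaces.linear scale scale g; inj g; \<A> \<inter> (`) g ` \<A> \<noteq> {}\<rbrakk>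
      \<Longrightarrow> (`) g ` \<A> = \<A>"
  shows "\<exists>A. \<A> = {A}"
proof (rule ccontr)
  assume not1: "\<nexists>A. \<A> = {A}"
  have ne: "\<A> \<noteq> {}" and "\<B> \<noteq> {}"
    using P by (auto simp: cross_pair_def nonempty_cross_intersecting_def)
  then obtain B where B: "B \<in> \<B>" by blast
  obtain C C' c where C: "C \<in> \<A>" "C' \<in> \<A>" "c \<in> C'" "c \<notin> C"
  proof -
    obtain C where "C \<in> \<A>" using ne by blast
    moreover then obtain C' where "C' \<in> \<A>" "C' \<noteq> C" using not1 by blast
    ultimately show ?thesis using that by blast
  qed
  note sub = cross_pairD(1)[OF P _ B]
  txt \<open>Moving \<open>C'\<close> by maps that fix \<open>C\<close> shows that the members of \<open>\<A>\<close> cover the space;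
    hence \<open>\<A>\<close> is invariant under every map that moves vectors by multiples of one vector.\<close>
  have cover: "\<exists>D\<in>\<A>. v \<in> D" for v
  proof (cases "v \<in> C")
    case False
    obtain g where g: "Vector_Spaces.linear scale scale g" "inj g"
      "\<And>u. u \<in> C \<Longrightarrow> g u = u" "g c = v"
      using shear_exists[OF sub[OF C(1)] C(4) False] by metis
    have "g ` C = C" using g(3) by simp
    then have "(`) g ` \<A> = \<A>" using C(1) by (intro block[OF g(1,2)]) blast
    then have "g ` C' \<in> \<A>" using C(2) by blast
    then show ?thesis using C(3) g(4) by blast
  qed (use C in blast)
  obtain D where D: "D \<in> \<A>" and min: "\<And>E. E \<in> \<A> \<Longrightarrow> dim (D \<inter> B) \<le> dim (E \<inter> B)"
    using ne arg_min_nat_lemma[of "\<lambda>D. D \<in> \<A>" _ "\<lambda>D. dim (D \<inter> B)"] by blast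
  note DB = cross_pairD[OF P D B]
  have "dim (D \<inter> B) \<noteq> 0" using DB(5) t by linarith
  then have "\<not> D \<inter> B \<subseteq> {0}" by simp
  then obtain x where x: "x \<in> D" "x \<in> B" "x \<noteq> 0" by blast
  \<comment> \<open>By \<open>small\<close>, \<open>D\<close> and \<open>B\<close> span a proper
    subspace; a vector \<open>y\<close> outside it will be the image of \<open>x\<close>.\<close>
  have "dim (span (D \<union> B)) < dim UNIV"
    using dim_span_Un_Int[of D B] DB small[of "dim D" "dim B"] by linarith
  then have "span (D \<union> B) \<noteq> UNIV" by (metis less_irrefl)
  then obtain y where y: "y \<notin> span (D \<union> B)" by blast
  obtain D0 where D0: "subspace D0" "D0 \<subseteq> D" "x \<notin> D0" "D = span (insert x D0)"
  proof -
    obtain F where F: "{x} \<subseteq> F" "F \<subseteq> D" "independent F" "D \<subseteq> span F"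
      using maximal_independent_subset_extend[of "{x}" D] x by auto
    have "x \<notin> span (F - {x})" using F dependent_def by blast
    moreover have "span (F - {x}) \<subseteq> D" using F DB by (intro span_minimal) auto
    moreover have "D = span (insert x (span (F - {x})))"
    proof
      have "F \<subseteq> insert x (span (F - {x}))" using span_superset[of "F - {x}"] by blast
      then show "D \<subseteq> span (insert x (span (F - {x})))"
        using F(4) span_mono by blast
      show "span (insert x (span (F - {x}))) \<subseteq> D"
        using x DB \<open>span (F - {x}) \<subseteq> D\<close> by (intro span_minimal) auto
    qed
    ultimately show ?thesis using that subspace_span by blast
  qed
  have y0: "y \<notin> D0" using y D0 span_superset by blast
  obtain g where g: "Vector_Spaces.linear scale scale g" "inj g"
      "\<And>u. u \<in> D0 \<Longrightarrow> g u = u" "g x = y" "\<And>z. g z - z \<in> span {y - x}"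
    using shear_exists[OF D0(1,3) y0] by metis
  \<comment> \<open>\<open>g\<close> moves vectors only along \<open>y - x\<close>, so a member
    containing this direction is mapped to itself, and \<open>block\<close> applies to
    \<open>g\<close>.\<close>
  obtain E where E: "E \<in> \<A>" "y - x \<in> E" using cover by blast
  have "g ` E \<subseteq> E"
  proof
    fix z assume "z \<in> g ` E"
    then obtain e where e: "e \<in> E" "z = g e" by blast
    have "span {y - x} \<subseteq> E" using E sub by (intro span_minimal) auto
    then have "g e - e \<in> E" using g(5) by blast
    then show "z \<in> E" using e subspace_add[OF sub[OF E(1)], of "g e - e" e] by simp
  qed
  then have "g ` E = E"
    using linear_inj_image[OF g(1,2) sub[OF E(1)]] sub[OF E(1)] subspace_dim_equal by simp
  then have "(`) g ` \<A> = \<A>" using E(1) by (intro block[OF g(1,2)]) blast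
  then have gD: "g ` D \<in> \<A>" using D by blast
  interpret g: Vector_Spaces.linear scale scale g by fact
  have "g ` D = span (insert y D0)"
    unfolding D0(4) g.span_image[symmetric] using g(3,4) by simp
  \<comment> \<open>Replacing \<open>x\<close> by \<open>y\<close>, which lies outside
    \<open>span (D \<union> B)\<close>, leaves only \<open>D0 \<inter> B\<close>, and this lacks
    \<open>x\<close>.\<close>
  then have "g ` D \<inter> B = D0 \<inter> B"
    using span_insert_Int[of D0 B y] D0 DB y span_mono[of "D0 \<union> B" "D \<union> B"] by auto
  moreover have "dim (D0 \<inter> B) < dim (D \<inter> B)"
    using x D0 DB by (intro subspace_ne_dim_less subspace_inter) auto
  ultimately show False using min[OF gD] by simp
qed

section \<open>Extending subspaces while intersections stay small\<close>

text \<open>If \<open>span (B \<union> A)\<close> is proper, a vector outside it does not enlarge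
  the intersection, and \<open>X\<close> is that span. Otherwise the dimension formula determines
  the new intersection, \<open>sm\<close> bounds it, and \<open>X = B\<close> works.\<close>

lemma proper_subspace_avoiding:
  assumes B: "subspace B" and A: "subspace A" and lt: "dim (B \<inter> A) < t"
    and sm: "dim B + dim A + 1 < dim UNIV + t" and B1: "B \<noteq> UNIV"
  obtains X where "subspace X" "X \<noteq> UNIV" "B \<subseteq> X"
    "\<And>v. v \<notin> X \<Longrightarrow> dim (span (insert v B) \<inter> A) < t"
proof (cases "span (B \<union> A) = UNIV")
  case False
  have "dim (span (insert v B) \<inter> A) < t" if "v \<notin> span (B \<union> A)" for v
    using span_insert_Int[OF B A that] lt by simp
  then show ?thesis using that False span_superset[of "B \<union> A"] by blast
next
  case True
  then have eq: "dim UNIV + dim (B \<inter> A) = dim B + dim A"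
    using dim_span_Un_Int[OF B A] by simp
  show ?thesis
  proof (rule that[OF B])
    fix v assume v: "v \<notin> B"
    have "dim (span (span (insert v B) \<union> A)) + dim (span (insert v B) \<inter> A)
        = dim (span (insert v B)) + dim A"
      by (rule dim_span_Un_Int[OF subspace_span A])
    moreover have "span (span (insert v B) \<union> A) = UNIV"
    proof -
      have "B \<union> A \<subseteq> span (insert v B) \<union> A" using span_superset by blast
      then show ?thesis using True span_mono by blast
    qed
    ultimately have "dim UNIV + dim (span (insert v B) \<inter> A) = Suc (dim B) + dim A"
      using dim_span_insert[OF B v] by simp
    then show "dim (span (insert v B) \<inter> A) < t" using sm by linarith
  qed (use B1 in auto)
qed

text \<open>One dimension is added at a time; \<open>A1\<close> and \<open>A2\<close> each forbid
  the vectors of a proper subspace, and the two subspaces do not cover the space.\<close>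

lemma extension_avoiding_two:
  assumes "subspace T" "dim T \<le> m" "m \<le> dim UNIV" "subspace A1" "subspace A2"
    and "dim (T \<inter> A1) < t" "dim (T \<inter> A2) < t"
    and "m + dim A1 < dim UNIV + t" "m + dim A2 < dim UNIV + t"
  shows "\<exists>B. subspace B \<and> T \<subseteq> B \<and> dim B = m \<and> dim (B \<inter> A1) < t \<and> dim (B \<inter> A2) < t"
  using assms(2,3,8,9)
proof (induction m rule: dec_induct)
  case base
  then show ?case using assms by blast
next
  case (step m)
  then obtain B where B: "subspace B" "T \<subseteq> B" "dim B = m" "dim (B \<inter> A1) < t" "dim (B \<inter> A2) < t"
    by auto
  then have B1: "B \<noteq> UNIV" using step.prems(1) by auto
  obtain X1 where X1: "subspace X1" "X1 \<noteq> UNIV" "B \<subseteq> X1"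
    "\<And>v. v \<notin> X1 \<Longrightarrow> dim (span (insert v B) \<inter> A1) < t"
    using proper_subspace_avoiding[OF B(1) assms(4) B(4) _ B1] B(3) step.prems by auto
  obtain X2 where X2: "subspace X2" "X2 \<noteq> UNIV" "B \<subseteq> X2"
    "\<And>v. v \<notin> X2 \<Longrightarrow> dim (span (insert v B) \<inter> A2) < t"
    using proper_subspace_avoiding[OF B(1) assms(5) B(5) _ B1] B(3) step.prems by auto
  obtain v where v: "v \<notin> X1" "v \<notin> X2"
    using proper_subspaces_not_cover[OF X1(1) X2(1) subspace_UNIV] X1(2) X2(2) by blast
  then have "v \<notin> B" using X1 by blast
  then have "dim (span (insert v B)) = Suc m" using dim_span_insert B by simp
  moreover have "T \<subseteq> span (insert v B)" using B span_superset by blast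
  ultimately show ?case using X1(4)[OF v(1)] X2(4)[OF v(2)] by blast
qed

text \<open>A vector \<open>v\<close> of \<open>A\<close> outside \<open>A1\<close> and
  \<open>A2\<close> is extended to a \<open>t\<close>-dimensional \<open>T\<close> inside
  \<open>A\<close>. As \<open>v\<close> is in \<open>T\<close>, both meet \<open>T\<close> in
  dimension below \<open>t\<close>, and this is kept while \<open>T\<close> grows to dimension
  \<open>m\<close>.\<close>

lemma meeting_one_avoiding_two:
  assumes "subspace A" "subspace A1" "subspace A2" "\<not> A \<subseteq> A1" "\<not> A \<subseteq> A2"
    and t: "0 < t" "t \<le> dim A" "t \<le> m" "m \<le> dim UNIV"
    and "m + dim A1 < dim UNIV + t" "m + dim A2 < dim UNIV + t"
  obtains B where "subspace B" "dim B = m" "t \<le> dim (B \<inter> A)"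
    "dim (B \<inter> A1) < t" "dim (B \<inter> A2) < t"
proof -
  obtain v where v: "v \<in> A" "v \<notin> A1" "v \<notin> A2"
    using proper_subspaces_not_cover assms(1-5) by metis
  have "dim (span {v}) \<le> t" using t by simp
  moreover have "span {v} \<subseteq> A" using v assms(1) by (intro span_minimal) auto
  ultimately obtain T where T: "subspace T" "span {v} \<subseteq> T" "T \<subseteq> A" "dim T = t"
    using superspace_exists[OF subspace_span _ assms(1), of "{v}" t] t by metis
  have vT: "v \<in> T" using T span_base by blast
  have lt: "dim (T \<inter> C) < t" if "subspace C" "v \<notin> C" for C
    using subspace_ne_dim_less[of "T \<inter> C" T] that T vT subspace_inter by blast
  obtain B where B: "subspace B" "T \<subseteq> B" "dim B = m" "dim (B \<inter> A1) < t" "dim (B \<inter> A2) < t"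
    using extension_avoiding_two[of T m A1 A2 t] assms lt v T by auto
  moreover have "t \<le> dim (B \<inter> A)"
    using dim_subset[of T "B \<inter> A"] T B by simp
  ultimately show ?thesis using that by blast
qed

section \<open>Optimal pairs are stars\<close>

text \<open>Maximality forces \<open>\<B>\<close> to be all of \<open>meeting t S A\<close>. If
  \<open>A\<close> had smaller dimension, a superspace of dimension \<open>Max R\<close> could join
  it, since enlarging a subspace only enlarges its intersections.\<close>

lemma optimal_singleton:
  assumes opt: "optimal t R S {A} \<B>" and R: "finite R" "R \<noteq> {}" "Max R \<le> dim UNIV"
  shows "dim A = Max R" "\<B> = meeting t S A"
proof -
  have P: "cross_pair t R S {A} \<B>" using opt by (simp add: optimal_def)
  then obtain B where B: "B \<in> \<B>" by (auto simp: cross_pair_def nonempty_cross_intersecting_def)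
  note AB = cross_pairD[OF P _ B, of A, simplified]
  show star: "\<B> = meeting t S A"
  proof -
    have "\<B> \<subseteq> meeting t S A"
      using P by (auto simp: meeting_def cross_pair_def nonempty_cross_intersecting_def Int_commute)
    moreover have "cross_pair t R S {A} (meeting t S A)"
      using P calculation
      by (auto simp: meeting_def cross_pair_def nonempty_cross_intersecting_def Int_commute)
    then have "card {A} + card (meeting t S A) \<le> card {A} + card \<B>"
      using opt unfolding optimal_def by blast
    ultimately show ?thesis by (intro card_seteq) auto
  qed
  show "dim A = Max R"
  proof (rule ccontr)
    assume ne: "dim A \<noteq> Max R"
    have le: "dim A \<le> Max R" using AB R by simp
    obtain C where C: "subspace C" "A \<subseteq> C" "dim C = Max R"
      using superspace_exists[OF AB(1) subset_UNIV subspace_UNIV le R(3)] by metis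
    have "cross_pair t R S {A, C} \<B>"
      unfolding cross_pair_def nonempty_cross_intersecting_def
    proof (intro conjI ballI)
      show "{A, C} \<subseteq> subspaces_of_dims scale R"
        using C AB R by (auto simp: mem_subspaces_of_dims)
      show "\<B> \<subseteq> subspaces_of_dims scale S"
        using P by (simp add: cross_pair_def)
      show "\<B> \<noteq> {}" using B by blast
      fix D E assume DE: "D \<in> {A, C}" "E \<in> \<B>"
      then have "A \<inter> E \<subseteq> D \<inter> E" using C by auto
      then have "dim (A \<inter> E) \<le> dim (D \<inter> E)" by (rule dim_subset)
      then show "t \<le> dim (D \<inter> E)" using cross_pairD(5)[OF P _ DE(2), of A] by simp
    qed simp
    then have "card {A, C} + card \<B> \<le> card {A} + card \<B>"
      using opt unfolding optimal_def by blast
    then show False using C ne by (cases "A = C") auto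
  qed
qed

lemma optimal_is_star:
  assumes opt: "optimal t R S \<A> \<B>" and le: "card \<A> \<le> card \<B>"
    and R: "finite R" "R \<noteq> {}" "Max R \<le> dim UNIV" and S: "finite S" "S \<noteq> {}" "Max S \<le> dim UNIV"
    and t: "0 < t" "t \<le> Max R" "t \<le> Max S" and small: "Max R + Max S < dim UNIV + t"
  shows "\<exists>A \<in> subspaces_of_dim scale (Max R). \<A> = {A} \<and> \<B> = meeting t S A"
  using opt le
proof (induction "card \<A>" arbitrary: \<A> \<B> rule: less_induct)
  case less
  have P: "cross_pair t R S \<A> \<B>" using less.prems by (simp add: optimal_def)
  have sub: "subspace A" "dim A \<le> Max R" if "A \<in> \<A>" for A
  proof -
    obtain B where "B \<in> \<B>" using P by (auto simp: cross_pair_def nonempty_cross_intersecting_def)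
    then show "subspace A" "dim A \<le> Max R" using cross_pairD[OF P that] R by auto
  qed
  have sm: "i + j < dim UNIV + t" if "i \<in> R" "j \<in> S" for i j
    using Max_ge[OF R(1) that(1)] Max_ge[OF S(1) that(2)] small by linarith
  show ?case
  proof (cases "\<forall>g. Vector_Spaces.linear scale scale g \<and> inj g \<and> \<A> \<inter> (`) g ` \<A> \<noteq> {}
      \<longrightarrow> (`) g ` \<A> = \<A>")
    case True
    then obtain A where A: "\<A> = {A}"
      using cross_pair_block_singleton[OF P t(1) sm] by metis
    then show ?thesis
      using optimal_singleton[of t R S A \<B>] less.prems R sub[of A]
      by (auto simp: subspaces_of_dim_def)
  next
    case False
    then obtain g where g: "Vector_Spaces.linear scale scale g" "inj g"
      and ne: "\<A> \<inter> (`) g ` \<A> \<noteq> {}" and neq: "(`) g ` \<A> \<noteq> \<A>" by blast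
    let ?A = "(`) g ` \<A>" and ?B = "(`) g ` \<B>"
    have inj: "inj ((`) g)" using g(2) by (simp add: inj_def inj_image_eq_iff)
    have cA: "card ?A = card \<A>" by (rule card_image[OF inj_on_subset[OF inj subset_UNIV]])
    \<comment> \<open>The two families differ but have equal size, so neither contains the other and
      each has a member besides the common \<open>A\<close>.\<close>
    have nsub: "\<not> \<A> \<subseteq> ?A" "\<not> ?A \<subseteq> \<A>"
      using neq cA by (metis card_subset_eq finite_families)+
    then have lt: "card (\<A> \<inter> ?A) < card \<A>" by (intro psubset_card_mono) auto
    have "card \<B> \<le> card (\<B> \<union> ?B)" by (intro card_mono) auto
    then obtain A where A: "A \<in> subspaces_of_dim scale (Max R)" "\<A> \<inter> ?A = {A}"
      and B: "\<B> \<union> ?B = meeting t S A"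
      using less.hyps[OF lt optimal_merge[OF less.prems g ne]] lt less.prems by auto
    obtain A1 A2 where A1: "A1 \<in> \<A>" "A1 \<noteq> A" and A2: "A2 \<in> ?A" "A2 \<noteq> A"
      using nsub A(2) by blast
    have Q: "cross_pair t R S ?A ?B" by (rule cross_pair_image[OF g P])
    have sA: "subspace A" "dim A = Max R" using A by (auto simp: subspaces_of_dim_def)
    have s1: "subspace A1" "dim A1 \<le> Max R" using sub A1 by auto
    have s2: "subspace A2" "dim A2 \<le> Max R"
      using A2 linear_inj_image[OF g] sub by auto
    have nA: "\<not> A \<subseteq> A1" "\<not> A \<subseteq> A2"
      using subspace_dim_equal[of A A1] subspace_dim_equal[of A A2] sA s1 s2 A1 A2 by auto
    \<comment> \<open>This \<open>B\<close> lies in \<open>meeting t S A\<close>, the union of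
      \<open>\<B>\<close> and its image, but \<open>A1\<close> excludes it from \<open>\<B>\<close>
      and \<open>A2\<close> from the image.\<close>
    obtain B where B': "subspace B" "dim B = Max S" "t \<le> dim (B \<inter> A)"
      "dim (B \<inter> A1) < t" "dim (B \<inter> A2) < t"
      using meeting_one_avoiding_two[of A A1 A2 t "Max S"] sA s1 s2 nA t S small by auto
    have "B \<in> meeting t S A" using B' S by (simp add: meeting_def mem_subspaces_of_dims)
    then have "B \<in> \<B> \<or> B \<in> ?B" using B by blast
    then show ?thesis
      using cross_pairD(5)[OF P A1(1), of B] cross_pairD(5)[OF Q A2(1), of B] B'
      by (auto simp: Int_commute)
  qed
qed

section \<open>Counting subspaces that meet a given subspace\<close>

text \<open>Linear independence of a list modulo a subspace \<open>X\<close>, stated entry by entry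
  so that lists can be counted by successive choices.\<close>

fun indep_over :: "'v set \<Rightarrow> 'v list \<Rightarrow> bool" where
  "indep_over X [] \<longleftrightarrow> True"
| "indep_over X (v # vs) \<longleftrightarrow> v \<notin> X \<and> indep_over (span (insert v X)) vs"

lemma indep_over_mono:
  "indep_over X vs \<Longrightarrow> Y \<subseteq> X \<Longrightarrow> indep_over Y vs"
proof (induction vs arbitrary: X Y)
  case (Cons v vs)
  have "span (insert v Y) \<subseteq> span (insert v X)" using Cons.prems by (intro span_mono) auto
  then show ?case using Cons by auto
qed simp

text \<open>An instance of the modular law: subtracting a multiple of \<open>v\<close> does not lead
  out of \<open>B\<close>.\<close>

lemma Int_span_insert:
  assumes B: "subspace B" and X: "subspace X" and v: "v \<in> B"
  shows "B \<inter> span (insert v X) = span (insert v (B \<inter> X))"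
proof
  show "B \<inter> span (insert v X) \<subseteq> span (insert v (B \<inter> X))"
  proof
    fix x assume x: "x \<in> B \<inter> span (insert v X)"
    then obtain c where c: "x - c *s v \<in> X"
      using X by (auto simp: span_insert span_of_subspace)
    have "x - c *s v \<in> B" using x v B subspace_diff subspace_scale by blast
    then show "x \<in> span (insert v (B \<inter> X))"
      using c B X by (auto simp: span_insert span_of_subspace subspace_inter)
  qed
  have "span (insert v (B \<inter> X)) \<subseteq> B" using B v by (intro span_minimal) auto
  moreover have "span (insert v (B \<inter> X)) \<subseteq> span (insert v X)" by (intro span_mono) auto
  ultimately show "span (insert v (B \<inter> X)) \<subseteq> B \<inter> span (insert v X)" by blast
qed

text \<open>By the modular law, intersecting with \<open>B\<close> commutes with the successive
  enlargements of \<open>X\<close> by entries from \<open>B\<close>.\<close>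

lemma indep_over_Int:
  assumes "subspace B" "subspace X" "set vs \<subseteq> B"
  shows "indep_over (B \<inter> X) vs \<longleftrightarrow> indep_over X vs"
  using assms
proof (induction vs arbitrary: X)
  case (Cons v vs)
  then show ?case
    using Int_span_insert[of B X v] Cons.IH[of "span (insert v X)"] by auto
qed simp

lemma span_insert_span_Un:
  "span (span (insert v X) \<union> Y) = span (insert v (X \<union> Y))"
proof
  have "span (insert v X) \<subseteq> span (insert v (X \<union> Y))" by (intro span_mono) auto
  moreover have "Y \<subseteq> span (insert v (X \<union> Y))" by (auto intro: span_base)
  ultimately show "span (span (insert v X) \<union> Y) \<subseteq> span (insert v (X \<union> Y))"
    by (intro span_minimal) auto
  show "span (insert v (X \<union> Y)) \<subseteq> span (span (insert v X) \<union> Y)"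
    using span_superset[of "insert v X"] by (intro span_mono) auto
qed

lemma dim_indep_over:
  "subspace X \<Longrightarrow> indep_over X vs \<Longrightarrow> dim (span (X \<union> set vs)) = dim X + length vs"
proof (induction vs arbitrary: X)
  case (Cons v vs)
  have "dim (span (span (insert v X) \<union> set vs)) = dim (span (insert v X)) + length vs"
    using Cons by (intro Cons.IH) auto
  then show ?case
    using Cons.prems dim_span_insert[of X v] by (simp add: span_insert_span_Un del: dim_span)
qed (simp add: span_of_subspace)

text \<open>After \<open>l\<close> entries the forbidden vectors form a subspace of dimension
  \<open>dim X + l\<close>. Once \<open>W\<close> is exhausted, a factor is 0.\<close>

lemma card_indep_over:
  assumes "subspace X" "subspace W" "X \<subseteq> W"
  shows "card {vs. length vs = d \<and> set vs \<subseteq> W \<and> indep_over X vs}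
    = (\<Prod>l<d. CARD('k) ^ dim W - CARD('k) ^ (dim X + l))"
  using assms(1,3)
proof (induction d arbitrary: X)
  case 0
  have "{vs. length vs = 0 \<and> set vs \<subseteq> W \<and> indep_over X vs} = {[]}" by auto
  then show ?case by simp
next
  case (Suc d)
  let ?T = "\<lambda>X d. {vs. length vs = d \<and> set vs \<subseteq> W \<and> indep_over X vs}"
  have eq: "?T X (Suc d) = (\<lambda>(v, vs). v # vs) ` (SIGMA v:W - X. ?T (span (insert v X)) d)"
    by (auto simp: length_Suc_conv image_iff)
  have fin: "finite (?T Y d)" for Y
    by (rule finite_subset[OF _ finite_lists_length_eq[of W d]]) auto
  have "card (?T X (Suc d)) = card (SIGMA v:W - X. ?T (span (insert v X)) d)"
    unfolding eq by (rule card_image) (auto simp: inj_on_def)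
  also have "\<dots> = (\<Sum>v\<in>W - X. card (?T (span (insert v X)) d))"
    using fin by (intro card_SigmaI) auto
  also have "\<dots> = (\<Sum>v\<in>W - X. \<Prod>l<d. CARD('k) ^ dim W - CARD('k) ^ (Suc (dim X) + l))"
  proof (rule sum.cong[OF refl])
    fix v assume v: "v \<in> W - X"
    then have "span (insert v X) \<subseteq> W" using Suc.prems assms(2) by (intro span_minimal) auto
    then show "card (?T (span (insert v X)) d)
        = (\<Prod>l<d. CARD('k) ^ dim W - CARD('k) ^ (Suc (dim X) + l))"
      using Suc.IH[OF subspace_span] dim_span_insert[of X v] v Suc.prems by simp
  qed
  also have "\<dots> = (CARD('k) ^ dim W - CARD('k) ^ dim X)
      * (\<Prod>l<d. CARD('k) ^ dim W - CARD('k) ^ (dim X + Suc l))"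
    using Suc.prems assms(2) by (simp add: card_Diff_subset card_subspace)
  finally show ?case by (simp only: prod.lessThan_Suc_shift add_0_right)
qed

text \<open>
  The lists of length \<open>d\<close> that are independent over \<open>X\<close> are sorted by the subspace that they
  span together with \<open>J\<close>. If \<open>dim X + d > dim W\<close>, a factor of the right-hand side is \<open>0\<close>.
\<close>

lemma card_complements:
  assumes J: "subspace J" and X: "subspace X" and W: "subspace W" and JX: "J \<subseteq> X" and XW: "X \<subseteq> W"
  shows "card {B. subspace B \<and> B \<subseteq> W \<and> B \<inter> X = J \<and> dim B = dim J + d}
      * (\<Prod>l<d. CARD('k) ^ (dim J + d) - CARD('k) ^ (dim J + l))
    = (\<Prod>l<d. CARD('k) ^ dim W - CARD('k) ^ (dim X + l))"
proof -
  let ?G = "{B. subspace B \<and> B \<subseteq> W \<and> B \<inter> X = J \<and> dim B = dim J + d}"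
  let ?T = "\<lambda>B X. {vs. length vs = d \<and> set vs \<subseteq> B \<and> indep_over X vs}"
  let ?f = "\<lambda>vs. span (J \<union> set vs)"
  have sub: "?f ` ?T W X \<subseteq> ?G"
  proof
    fix B assume "B \<in> ?f ` ?T W X"
    then obtain vs where vs: "length vs = d" "set vs \<subseteq> W" "indep_over X vs" and B: "B = ?f vs"
      by blast
    have BW: "B \<subseteq> W" unfolding B using vs JX XW W by (intro span_minimal) auto
    have "indep_over J vs" using vs JX indep_over_mono by blast
    then have dB: "dim B = dim J + d" using dim_indep_over[OF J] vs B by simp
    have JB: "J \<subseteq> B \<inter> X" unfolding B using JX by (auto intro: span_base)
    have "span (B \<union> X) = span (X \<union> set vs)"
    proof
      have "B \<subseteq> span (X \<union> set vs)" unfolding B using JX by (intro span_mono) auto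
      then show "span (B \<union> X) \<subseteq> span (X \<union> set vs)"
        using span_superset[of "X \<union> set vs"] by (intro span_minimal) auto
      show "span (X \<union> set vs) \<subseteq> span (B \<union> X)"
        unfolding B by (intro span_mono) (auto intro: span_base)
    qed
    \<comment> \<open>The list raises the dimension of \<open>X\<close> by \<open>d\<close>, as it
      does for \<open>J\<close>, so the dimension formula leaves exactly \<open>dim J\<close> for
      \<open>B \<inter> X\<close>.\<close>
    then have "dim (span (B \<union> X)) = dim X + d" using dim_indep_over[OF X vs(3)] vs(1) by simp
    moreover have sB: "subspace B" unfolding B by simp
    ultimately have "dim (B \<inter> X) = dim J"
      using dim_span_Un_Int[of B X] X dB by simp
    then have "B \<inter> X = J"
      using subspace_dim_equal[of J "B \<inter> X"] J JB sB X subspace_inter by auto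
    then show "B \<in> ?G" using sB BW dB by blast
  qed
  have fib: "{vs \<in> ?T W X. ?f vs = B} = ?T B J" if "B \<in> ?G" for B
  proof (intro equalityI subsetI)
    fix vs assume "vs \<in> {vs \<in> ?T W X. ?f vs = B}"
    then show "vs \<in> ?T B J" using indep_over_mono[of X vs J] JX span_superset[of "J \<union> set vs"] by auto
  next
    fix vs assume vs: "vs \<in> ?T B J"
    have BX: "B \<inter> X = J" and sB: "subspace B" using that by auto
    have "indep_over X vs" using indep_over_Int[of B X vs] vs that X by simp
    moreover have "?f vs = B"
    proof (rule subspace_dim_equal)
      show "?f vs \<subseteq> B" using vs BX sB by (intro span_minimal) auto
      show "dim B \<le> dim (?f vs)" using dim_indep_over[OF J, of vs] vs that by simp
    qed (use sB in auto)
    ultimately show "vs \<in> {vs \<in> ?T W X. ?f vs = B}" using vs that by auto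
  qed
  have fin: "finite (?T W X)"
    by (rule finite_subset[OF _ finite_lists_length_eq[of W d]]) auto
  have "card (?T W X) = (\<Sum>B\<in>?G. card {vs \<in> ?T W X. ?f vs = B})"
    by (rule card_eq_sum_fibers[OF fin finite_families sub])
  also have "\<dots> = (\<Sum>B\<in>?G. \<Prod>l<d. CARD('k) ^ (dim J + d) - CARD('k) ^ (dim J + l))"
  proof (rule sum.cong[OF refl])
    fix B assume B: "B \<in> ?G"
    then show "card {vs \<in> ?T W X. ?f vs = B}
        = (\<Prod>l<d. CARD('k) ^ (dim J + d) - CARD('k) ^ (dim J + l))"
      unfolding fib[OF B] using card_indep_over[of J B d] J by auto
  qed
  finally show ?thesis using card_indep_over[OF X W XW, of d] by simp
qed

section \<open>Counts in terms of Gaussian binomial coefficients\<close>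

text \<open>When \<open>x + l\<close> exceeds \<open>w\<close>, truncated subtraction makes both
  sides 0, as in the numerators of \<open>gauss_binomial\<close>.\<close>

lemma real_diff_powers:
  assumes "x \<le> w"
  shows "real (CARD('k) ^ w - CARD('k) ^ (x + l))
    = real CARD('k) ^ x * (real CARD('k) ^ l * (real CARD('k) ^ (w - x - l) - 1))"
proof (cases "x + l \<le> w")
  case True
  then have "w = x + l + (w - x - l)" by simp
  then have eq: "real CARD('k) ^ w = real CARD('k) ^ (x + l) * real CARD('k) ^ (w - x - l)"
    by (metis power_add)
  have "CARD('k) ^ (x + l) \<le> CARD('k) ^ w" using True card_scalars_ge_2 by (intro power_increasing) auto
  then show ?thesis by (simp add: of_nat_diff eq power_add algebra_simps)
next
  case False
  then have "CARD('k) ^ w \<le> CARD('k) ^ (x + l)" using card_scalars_ge_2 by (intro power_increasing) auto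
  then show ?thesis using False by simp
qed

text \<open>In the quotient of the two products from \<open>card_complements\<close> the powers
  \<open>?q ^ l\<close> cancel, and the leading powers leave the exponent
  \<open>(dim X - dim J) * d\<close>.\<close>

lemma card_complements_gauss:
  assumes J: "subspace J" and X: "subspace X" and W: "subspace W" and JX: "J \<subseteq> X" and XW: "X \<subseteq> W"
  shows "real (card {B. subspace B \<and> B \<subseteq> W \<and> B \<inter> X = J \<and> dim B = dim J + d})
    = real CARD('k) ^ ((dim X - dim J) * d) * gauss_binomial CARD('k) (dim W - dim X) d"
    (is "real ?N = _")
proof -
  let ?q = "real CARD('k)"
  have q: "?q \<ge> 2" using card_scalars_ge_2 by simp
  have dJ: "dim J \<le> dim X" "dim X \<le> dim W" using JX XW dim_subset by auto
  have p1: "(\<Prod>l<d. real (CARD('k) ^ (dim J + d) - CARD('k) ^ (dim J + l)))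
      = (?q ^ dim J) ^ d * ((\<Prod>l<d. ?q ^ l) * (\<Prod>l<d. ?q ^ (d - l) - 1))"
    by (simp add: real_diff_powers prod.distrib)
  have p2: "(\<Prod>l<d. real (CARD('k) ^ dim W - CARD('k) ^ (dim X + l)))
      = (?q ^ dim X) ^ d * ((\<Prod>l<d. ?q ^ l) * (\<Prod>l<d. ?q ^ (dim W - dim X - l) - 1))"
    using dJ by (simp add: real_diff_powers prod.distrib)
  have "real ?N * (\<Prod>l<d. real (CARD('k) ^ (dim J + d) - CARD('k) ^ (dim J + l)))
      = (\<Prod>l<d. real (CARD('k) ^ dim W - CARD('k) ^ (dim X + l)))"
    using arg_cong[OF card_complements[OF assms, of d], of real]
    by (simp only: of_nat_mult of_nat_prod)
  then have eq: "real ?N * (?q ^ dim J) ^ d * (\<Prod>l<d. ?q ^ (d - l) - 1) * (\<Prod>l<d. ?q ^ l)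
      = (?q ^ dim X) ^ d * (\<Prod>l<d. ?q ^ (dim W - dim X - l) - 1) * (\<Prod>l<d. ?q ^ l)"
    unfolding p1 p2 by (simp only: ac_simps)
  have "(\<Prod>l<d. ?q ^ l) \<noteq> 0" using q by (simp add: prod_zero_iff)
  then have eq2: "real ?N * (?q ^ dim J) ^ d * (\<Prod>l<d. ?q ^ (d - l) - 1)
      = (?q ^ dim X) ^ d * (\<Prod>l<d. ?q ^ (dim W - dim X - l) - 1)"
    using eq by simp
  have "?q ^ (d - l) > 1" if "l < d" for l using q that by (intro one_less_power) auto
  then have D: "(\<Prod>l<d. ?q ^ (d - l) - 1) \<noteq> 0" by (force simp: prod_zero_iff)
  have "(?q ^ dim X) ^ d = (?q ^ dim J) ^ d * ?q ^ ((dim X - dim J) * d)"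
    using dJ by (simp add: power_mult[symmetric] power_add[symmetric] add_mult_distrib[symmetric])
  then have "(?q ^ dim J) ^ d * (real ?N * (\<Prod>l<d. ?q ^ (d - l) - 1))
      = (?q ^ dim J) ^ d * (?q ^ ((dim X - dim J) * d) * (\<Prod>l<d. ?q ^ (dim W - dim X - l) - 1))"
    using eq2 by (simp only: ac_simps)
  then have "real ?N * (\<Prod>l<d. ?q ^ (d - l) - 1)
      = ?q ^ ((dim X - dim J) * d) * (\<Prod>l<d. ?q ^ (dim W - dim X - l) - 1)"
    using q by simp
  then show ?thesis
    using D by (simp add: gauss_binomial_def prod_dividef field_simps)
qed

text \<open>Every subspace meets the zero space in the zero space, so this is the case
  \<open>J = X = {0}\<close>.\<close>

lemma card_subspaces_of:
  assumes "subspace A"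
  shows "real (card {J. subspace J \<and> J \<subseteq> A \<and> dim J = j}) = gauss_binomial CARD('k) (dim A) j"
proof -
  have "{J. subspace J \<and> J \<subseteq> A \<and> dim J = j}
      = {J. subspace J \<and> J \<subseteq> A \<and> J \<inter> {0} = {0} \<and> dim J = dim {0} + j}"
    using subspace_0 by auto
  then show ?thesis
    using card_complements_gauss[of "{0}" "{0}" A j] assms subspace_0 by simp
qed

text \<open>The subspaces are sorted by \<open>j = dim (B \<inter> A)\<close> and then by
  \<open>J = B \<inter> A\<close>; all \<open>J\<close> of dimension \<open>j\<close> have equally
  many \<open>B\<close> above them.\<close>

lemma card_meeting_singleton:
  assumes A: "subspace A"
  shows "real (card (meeting t {i} A)) = meet_sum CARD('k) (dim UNIV) t (dim A) {i}"
proof -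
  let ?M = "meeting t {i} A"
  let ?q = "real CARD('k)"
  have sM: "subspace B" "dim B = i" "t \<le> dim (B \<inter> A)" if "B \<in> ?M" for B
    using that by (auto simp: meeting_def mem_subspaces_of_dims)
  have "(\<lambda>B. dim (B \<inter> A)) ` ?M \<subseteq> {t..i}"
  proof
    fix j assume "j \<in> (\<lambda>B. dim (B \<inter> A)) ` ?M"
    then obtain B where "B \<in> ?M" "j = dim (B \<inter> A)" by blast
    then show "j \<in> {t..i}" using sM[of B] dim_subset[of "B \<inter> A" B] by simp
  qed
  then have "card ?M = (\<Sum>j=t..i. card {B \<in> ?M. dim (B \<inter> A) = j})"
    by (intro card_eq_sum_fibers) auto
  moreover have "real (card {B \<in> ?M. dim (B \<inter> A) = j})
      = ?q ^ ((dim A - j) * (i - j)) * gauss_binomial CARD('k) (dim A) j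
        * gauss_binomial CARD('k) (dim UNIV - dim A) (i - j)" if j: "j \<in> {t..i}" for j
  proof -
    let ?Mj = "{B \<in> ?M. dim (B \<inter> A) = j}" and ?S = "{J. subspace J \<and> J \<subseteq> A \<and> dim J = j}"
    have "(\<lambda>B. B \<inter> A) ` ?Mj \<subseteq> ?S" using sM A subspace_inter by auto
    then have "card ?Mj = (\<Sum>J\<in>?S. card {B \<in> ?Mj. B \<inter> A = J})"
      by (intro card_eq_sum_fibers) auto
    then have "real (card ?Mj) = (\<Sum>J\<in>?S. real (card {B \<in> ?Mj. B \<inter> A = J}))" by simp
    also have "\<dots> = (\<Sum>J\<in>?S. ?q ^ ((dim A - j) * (i - j))
        * gauss_binomial CARD('k) (dim UNIV - dim A) (i - j))"
    proof (rule sum.cong[OF refl])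
      fix J assume J: "J \<in> ?S"
      then have "{B \<in> ?Mj. B \<inter> A = J}
          = {B. subspace B \<and> B \<subseteq> UNIV \<and> B \<inter> A = J \<and> dim B = dim J + (i - j)}"
        using j by (auto simp: meeting_def mem_subspaces_of_dims)
      then show "real (card {B \<in> ?Mj. B \<inter> A = J}) = ?q ^ ((dim A - j) * (i - j))
          * gauss_binomial CARD('k) (dim UNIV - dim A) (i - j)"
        using card_complements_gauss[of J A UNIV "i - j"] J A by (simp del: dim_UNIV)
    qed
    also have "\<dots> = gauss_binomial CARD('k) (dim A) j * (?q ^ ((dim A - j) * (i - j))
        * gauss_binomial CARD('k) (dim UNIV - dim A) (i - j))"
      by (simp only: sum_constant card_subspaces_of[OF A])
    finally show ?thesis by (simp only: ac_simps)
  qed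
  ultimately show ?thesis by (simp add: meet_sum_def del: dim_UNIV)
qed

lemma card_meeting_eq_sum:
  assumes "finite S"
  shows "card (meeting t S A) = (\<Sum>i\<in>S. card (meeting t {i} A))"
proof -
  have "card (meeting t S A) = (\<Sum>i\<in>S. card {B \<in> meeting t S A. dim B = i})"
    using assms by (intro card_eq_sum_fibers) (auto simp: meeting_def mem_subspaces_of_dims)
  also have "\<dots> = (\<Sum>i\<in>S. card (meeting t {i} A))"
    by (intro sum.cong refl arg_cong[of _ _ card]) (auto simp: meeting_def mem_subspaces_of_dims)
  finally show ?thesis .
qed

lemma card_meeting:
  assumes "finite S" "subspace A"
  shows "real (card (meeting t S A)) = meet_sum CARD('k) (dim UNIV) t (dim A) S"
proof -
  have "real (card (meeting t S A)) = (\<Sum>i\<in>S. meet_sum CARD('k) (dim UNIV) t (dim A) {i})"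
    using card_meeting_eq_sum[OF assms(1)] card_meeting_singleton[OF assms(2)] by simp
  then show ?thesis by (simp add: meet_sum_def)
qed

section \<open>Comparison of the two stars\<close>

text \<open>This gives the number of hyperplanes of a space of dimension \<open>Suc i\<close>. The
  factor at \<open>l\<close> is \<open>f l / f (Suc l)\<close>, so the product telescopes.\<close>

lemma gauss_binomial_hyperplanes:
  "gauss_binomial CARD('k) (Suc i) i * (real CARD('k) - 1) = real CARD('k) ^ Suc i - 1"
proof -
  define f where "f l = real CARD('k) ^ (Suc i - l) - 1" for l
  have q: "real CARD('k) \<ge> 2" using card_scalars_ge_2 by simp
  have "real CARD('k) ^ (Suc i - l) > 1" if "l \<le> i" for l
    using q that by (intro one_less_power) auto
  then have "f l \<noteq> 0" if "l \<le> i" for l using that by (force simp: f_def)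
  then have "(\<Prod>l<i. f l / f (Suc l)) = f 0 / f i" by (rule prod_lessThan_telescope')
  then show ?thesis using q by (simp add: gauss_binomial_def f_def)
qed

text \<open>Pairs of a \<open>B\<close> in layer \<open>i\<close> and a vector \<open>v\<close>
  outside it are sent to \<open>span (insert v B)\<close>, which has property \<open>P\<close> by
  \<open>up\<close>. Each \<open>B\<close> is in \<open>?q ^ ?n - ?q ^ i\<close> pairs, each target
  receives at most \<open>(?q ^ Suc i - 1) * ?q ^ i\<close>, and the first number is at least twice
  the second.\<close>

lemma card_layer_doubling:
  assumes up: "\<And>B C. P B \<Longrightarrow> B \<subseteq> C \<Longrightarrow> P C" and i: "2 * Suc i \<le> dim UNIV"
  shows "2 * card {B. subspace B \<and> dim B = i \<and> P B} \<le> card {B. subspace B \<and> dim B = Suc i \<and> P B}"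
proof -
  let ?F = "\<lambda>i. {B. subspace B \<and> dim B = i \<and> P B}"
  let ?q = "CARD('k)" and ?n = "dim UNIV"
  let ?Z = "SIGMA B:?F i. - B"
  let ?f = "\<lambda>(B, v). span (insert v B)"
  let ?h = "real (?q ^ Suc i - 1)"
  have q: "?q \<ge> 2" by (rule card_scalars_ge_2)
  have pow: "?q ^ a \<le> ?q ^ b" if "a \<le> b" for a b
    using that q by (intro power_increasing) auto
  have finZ: "finite ?Z" by (intro finite_SigmaI) auto
  have cZ: "card ?Z = card (?F i) * (?q ^ ?n - ?q ^ i)"
    by (subst card_SigmaI) (auto simp: card_Diff_subset Compl_eq_Diff_UNIV card_subspace simp del: dim_UNIV)
  have "?f ` ?Z \<subseteq> ?F (Suc i)"
  proof clarify
    fix B v assume B: "subspace B" "P B" "v \<notin> B" "i = dim B"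
    have "B \<subseteq> span (insert v B)" using span_superset by blast
    then show "subspace (span (insert v B)) \<and> dim (span (insert v B)) = Suc (dim B) \<and> P (span (insert v B))"
      using up B dim_span_insert by blast
  qed
  then have "card ?Z = (\<Sum>C\<in>?F (Suc i). card {z \<in> ?Z. ?f z = C})"
    by (intro card_eq_sum_fibers finZ finite_families)
  then have "real (card ?Z) = (\<Sum>C\<in>?F (Suc i). real (card {z \<in> ?Z. ?f z = C}))" by simp
  also have "\<dots> \<le> (\<Sum>C\<in>?F (Suc i). ?h * real ?q ^ i)"
  proof (rule sum_mono)
    fix C assume C: "C \<in> ?F (Suc i)"
    let ?H = "{J. subspace J \<and> J \<subseteq> C \<and> dim J = i}"
    \<comment> \<open>A pair sent to \<open>C\<close> is a hyperplane of \<open>C\<close> with a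
      vector of \<open>C\<close> outside it. Hyperplanes without \<open>P\<close> are counted as
      well, so this gives an upper bound.\<close>
    have sub: "{z \<in> ?Z. ?f z = C} \<subseteq> (SIGMA J:?H. C - J)"
    proof
      fix z assume z: "z \<in> {z \<in> ?Z. ?f z = C}"
      then obtain B v where Bv: "z = (B, v)" "B \<in> ?F i" "v \<notin> B" "C = span (insert v B)" by auto
      have "insert v B \<subseteq> C" unfolding Bv by (rule span_superset)
      then show "z \<in> (SIGMA J:?H. C - J)" using Bv by auto
    qed
    have "card {z \<in> ?Z. ?f z = C} \<le> card (SIGMA J:?H. C - J)"
      by (rule card_mono[OF finite_SigmaI[OF finite_families finite_vectors] sub])
    also have "\<dots> = (\<Sum>J\<in>?H. ?q ^ Suc i - ?q ^ i)"
      using C by (subst card_SigmaI) (auto simp: card_Diff_subset card_subspace intro!: sum.cong)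
    also have "\<dots> = card ?H * (?q ^ Suc i - ?q ^ i)" by simp
    finally have "real (card {z \<in> ?Z. ?f z = C}) \<le> real (card ?H) * real (?q ^ Suc i - ?q ^ i)"
      unfolding of_nat_mult[symmetric] of_nat_le_iff .
    also have "real (?q ^ Suc i - ?q ^ i) = (real ?q - 1) * real ?q ^ i"
      using pow[of i "Suc i"] by (simp add: of_nat_diff algebra_simps)
    also have "real (card ?H) = gauss_binomial ?q (Suc i) i"
      using C card_subspaces_of[of C i] by simp
    also have "gauss_binomial ?q (Suc i) i * ((real ?q - 1) * real ?q ^ i) = ?h * real ?q ^ i"
      unfolding mult.assoc[symmetric] gauss_binomial_hyperplanes
      using q by (simp add: of_nat_diff)
    finally show "real (card {z \<in> ?Z. ?f z = C}) \<le> ?h * real ?q ^ i" .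
  qed
  also have "\<dots> = real (card (?F (Suc i)) * ((?q ^ Suc i - 1) * ?q ^ i))" by simp
  finally have le: "card (?F i) * (?q ^ ?n - ?q ^ i) \<le> card (?F (Suc i)) * ((?q ^ Suc i - 1) * ?q ^ i)"
    unfolding cZ of_nat_le_iff .
  have "2 * (?q ^ Suc i - 1) * ?q ^ i \<le> ?q ^ ?n - ?q ^ i"
  proof -
    \<comment> \<open>The factor 2 is absorbed by one more factor \<open>?q\<close>, and the
      exponent \<open>2 * Suc i\<close> is at most the dimension.\<close>
    have "2 * ?q ^ Suc i * ?q ^ i \<le> ?q * ?q ^ Suc i * ?q ^ i" using q by simp
    also have "\<dots> = ?q ^ (2 * Suc i)" by (simp add: power_add mult_2)
    also have "\<dots> \<le> ?q ^ ?n" by (rule pow[OF i])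
    finally have "2 * ?q ^ Suc i * ?q ^ i - ?q ^ i \<le> ?q ^ ?n - ?q ^ i" by (rule diff_le_mono)
    moreover have "2 * (?q ^ Suc i - 1) * ?q ^ i \<le> 2 * ?q ^ Suc i * ?q ^ i - ?q ^ i"
      by (simp add: diff_mult_distrib diff_mult_distrib2)
    ultimately show ?thesis by linarith
  qed
  then have "card (?F i) * (2 * (?q ^ Suc i - 1) * ?q ^ i)
      \<le> card (?F (Suc i)) * ((?q ^ Suc i - 1) * ?q ^ i)"
    using order_trans[OF mult_le_mono2 le] by blast
  then have "2 * card (?F i) * ((?q ^ Suc i - 1) * ?q ^ i)
      \<le> card (?F (Suc i)) * ((?q ^ Suc i - 1) * ?q ^ i)"
    by (simp only: ac_simps)
  moreover have "0 < (?q ^ Suc i - 1) * ?q ^ i"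
    using one_less_power[of ?q "Suc i"] q by simp
  ultimately show ?thesis unfolding mult_le_cancel2 by blast
qed

lemma meeting_singleton_eq:
  "meeting t {i} A = {B. subspace B \<and> dim B = i \<and> t \<le> dim (B \<inter> A)}"
  by (auto simp: meeting_def mem_subspaces_of_dims)

lemma card_meeting_doubling:
  assumes "2 * Suc i \<le> dim UNIV"
  shows "2 * card (meeting t {i} A) \<le> card (meeting t {Suc i} A)"
proof -
  have "t \<le> dim (C \<inter> A)" if "t \<le> dim (B \<inter> A)" "B \<subseteq> C" for B C
    using dim_subset[OF Int_mono[OF that(2) subset_refl], of A] that(1) by simp
  then show ?thesis
    unfolding meeting_singleton_eq using assms by (intro card_layer_doubling) blast+
qed

text \<open>A \<open>t\<close>-dimensional subspace of \<open>A\<close> makes the lowest layer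
  non-empty; from there each layer is at least twice the previous one.\<close>

lemma sum_card_meeting_less:
  assumes A: "subspace A" "t \<le> dim A" and m: "t \<le> m" "2 * m \<le> dim UNIV"
  shows "(\<Sum>i=t..<m. card (meeting t {i} A)) < card (meeting t {m} A)"
proof (rule sum_less_of_doubling)
  obtain T where "subspace T" "T \<subseteq> A" "dim T = t"
    using superspace_exists[of "{0}" A t] A subspace_0 by auto
  then have "T \<in> meeting t {t} A" by (simp add: meeting_singleton_eq Int_absorb2)
  then show "0 < card (meeting t {t} A)" by (auto simp: card_gt_0_iff)
  show "2 * card (meeting t {i} A) \<le> card (meeting t {Suc i} A)" if "t \<le> i" "i < m" for i
    using that m by (intro card_meeting_doubling) simp
qed (fact m)

lemma card_subspaces_of_dim_doubling:
  assumes "2 * s \<le> dim UNIV" "r < s"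
  shows "2 * card (subspaces_of_dim scale r) \<le> card (subspaces_of_dim scale s)"
proof -
  have eq: "subspaces_of_dim scale i = {B. subspace B \<and> dim B = i \<and> True}" for i
    by (simp add: subspaces_of_dim_def)
  have step: "2 * card (subspaces_of_dim scale i) \<le> card (subspaces_of_dim scale (Suc i))"
    if "i < s" for i
    unfolding eq by (rule card_layer_doubling) (use that assms in auto)
  have "Suc r \<le> s" using assms by simp
  then show ?thesis
    using step assms(2)
  proof (induction s rule: dec_induct)
    case (step n)
    then have "2 * card (subspaces_of_dim scale r) \<le> card (subspaces_of_dim scale n)" by auto
    also have "\<dots> \<le> card (subspaces_of_dim scale (Suc n))" using step.prems(1)[of n] by simp
    finally show ?case .
  qed auto
qed

lemma card_subspaces_of_dim_pos: "r \<le> dim UNIV \<Longrightarrow> card (subspaces_of_dim scale r) > 0"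
  using superspace_exists[of "{0}" UNIV r]
  by (auto simp: card_gt_0_iff subspaces_of_dim_def)

text \<open>Pairs of subspaces of the two dimensions that meet in dimension at least
  \<open>t\<close> are counted from either side; the number of partners depends only on the
  dimension.\<close>

lemma card_meeting_double_count:
  assumes A: "subspace A" and B: "subspace B"
  shows "card (subspaces_of_dim scale (dim A)) * card (meeting t {dim B} A)
    = card (subspaces_of_dim scale (dim B)) * card (meeting t {dim A} B)"
proof -
  have const: "card (meeting t {i} C) = card (meeting t {i} D)"
    if "subspace C" "subspace D" "dim C = dim D" for C D i
    using card_meeting_singleton[OF that(1), of t i] card_meeting_singleton[OF that(2), of t i] that(3)
    by simp
  let ?N = "subspaces_of_dim scale"
  let ?Z = "\<lambda>a b. SIGMA C:?N a. meeting t {b} C"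
  have cZ: "card (?Z (dim C) b) = card (?N (dim C)) * card (meeting t {b} C)" if C: "subspace C" for C b
  proof -
    have "card (?Z (dim C) b) = (\<Sum>D\<in>?N (dim C). card (meeting t {b} D))"
      by (rule card_SigmaI) auto
    also have "\<dots> = (\<Sum>D\<in>?N (dim C). card (meeting t {b} C))"
      using C by (intro sum.cong refl const) (auto simp: subspaces_of_dim_def)
    finally show ?thesis by simp
  qed
  have "?Z (dim A) (dim B) = (\<lambda>(D, C). (C, D)) ` ?Z (dim B) (dim A)"
    by (auto simp: meeting_singleton_eq subspaces_of_dim_def Int_commute image_iff)
  then have "card (?Z (dim A) (dim B)) = card (?Z (dim B) (dim A))"
    by (simp add: card_image inj_on_def)
  then show ?thesis using cZ[OF A, of "dim B"] cZ[OF B, of "dim A"] by simp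
qed

text \<open>If the maxima agree, \<open>R\<close> and \<open>S\<close> coincide above
  \<open>?d\<close>, and layer \<open>?d\<close> outweighs all lower ones. If
  \<open>Max R < Max S\<close>, the left side is below twice its layer \<open>Max R\<close>; double
  counting and the growth of the number of subspaces make the layer \<open>Max S\<close> on the
  right at least that large.\<close>

lemma card_meeting_less:
  assumes A: "subspace A" "dim A = Max R" and B: "subspace B" "dim B = Max S"
    and R: "finite R" "R \<noteq> {}" "R \<subseteq> {t..}" and S: "finite S" "S \<noteq> {}" "S \<subseteq> {t..}"
    and ne: "R \<noteq> S" and mx: "Max (sym_diff R S) \<in> S"
    and n: "2 * Max S \<le> dim UNIV"
  shows "card (meeting t R B) < card (meeting t S A)"
proof -
  let ?D = "sym_diff R S"
  have D: "finite ?D" "?D \<noteq> {}" using R S ne by auto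
  \<comment> \<open>Otherwise \<open>Max R\<close> would lie in the symmetric difference and exceed
    every element of \<open>S\<close>, contrary to \<open>mx\<close>.\<close>
  have "Max R \<le> Max S"
  proof (rule ccontr)
    assume "\<not> Max R \<le> Max S"
    then have lt: "Max S < Max R" by simp
    then have "Max R \<notin> S" using Max_ge[OF S(1)] by force
    then have "Max R \<in> ?D" using R Max_in by blast
    then have "Max R \<le> Max ?D" using D by simp
    also have "\<dots> \<le> Max S" using mx S by simp
    finally show False using lt by simp
  qed
  have tR: "t \<le> Max R" and tS: "t \<le> Max S" using R S Max_in by blast+
  show ?thesis
  proof (cases "Max R = Max S")
    case True
    let ?d = "Max ?D"
    let ?c = "\<lambda>i. card (meeting t {i} A)"
    have cB: "card (meeting t {i} B) = ?c i" for i
      using card_meeting_singleton[OF A(1), of t i] card_meeting_singleton[OF B(1), of t i] A B True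
      by simp
    have dn: "?d \<notin> R" using Max_in[OF D] mx by blast
    have above: "R \<inter> {?d<..} = S \<inter> {?d<..}"
    proof (rule ccontr)
      assume "R \<inter> {?d<..} \<noteq> S \<inter> {?d<..}"
      then obtain x where "x \<in> ?D" "?d < x" by auto
      then show False using Max_ge[OF D(1), of x] by simp
    qed
    have td: "t \<le> ?d" and ds: "?d \<le> Max S" using mx S by auto
    have "card (meeting t R B) = sum ?c R" using card_meeting_eq_sum[OF R(1)] cB by simp
    also have "\<dots> = sum ?c (R \<inter> {?d<..}) + sum ?c (R \<inter> {..<?d})"
      using R dn by (subst sum.union_disjoint[symmetric]) (auto intro!: sum.cong simp: not_less le_less)
    also have "sum ?c (R \<inter> {..<?d}) \<le> sum ?c {t..<?d}"
      using R by (intro sum_mono2) auto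
    also have "\<dots> < ?c ?d"
      using sum_card_meeting_less[OF A(1)] A tR td ds n by simp
    also have "sum ?c (R \<inter> {?d<..}) + ?c ?d = sum ?c (insert ?d (S \<inter> {?d<..}))"
      using S by (simp add: above)
    also have "\<dots> \<le> sum ?c S" using S mx by (intro sum_mono2) auto
    also have "\<dots> = card (meeting t S A)" using card_meeting_eq_sum[OF S(1)] by simp
    finally show ?thesis by simp
  next
    case False
    then have lt: "Max R < Max S" using \<open>Max R \<le> Max S\<close> by simp
    let ?c = "\<lambda>i. card (meeting t {i} B)"
    have "card (meeting t R B) = sum ?c R" by (rule card_meeting_eq_sum[OF R(1)])
    also have "\<dots> \<le> sum ?c {t..<Suc (Max R)}"
      using R by (intro sum_mono2) (auto simp: less_Suc_eq_le)
    also have "\<dots> = sum ?c {t..<Max R} + ?c (Max R)" using tR by simp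
    also have "sum ?c {t..<Max R} < ?c (Max R)"
      using B tS tR lt n by (intro sum_card_meeting_less) auto
    finally have 1: "card (meeting t R B) < 2 * ?c (Max R)" by simp
    have "card (subspaces_of_dim scale (Max R)) * (2 * ?c (Max R))
        \<le> card (subspaces_of_dim scale (Max S)) * ?c (Max R)"
      using card_subspaces_of_dim_doubling[OF n lt] by simp
    also have "\<dots> = card (subspaces_of_dim scale (Max R)) * card (meeting t {Max S} A)"
      using card_meeting_double_count[OF A(1) B(1), of t] A B by simp
    finally have "2 * ?c (Max R) \<le> card (meeting t {Max S} A)"
      using card_subspaces_of_dim_pos[of "Max R"] lt n by simp
    also have "\<dots> \<le> card (meeting t S A)"
      using Max_in[OF S(1,2)] by (intro card_mono) (auto simp: meeting_def mem_subspaces_of_dims)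
    finally show ?thesis using 1 by simp
  qed
qed

end

section \<open>The upper bound and the cases of equality\<close>

theorem theorem1p2:
  fixes scale :: "'k::{field,finite} \<Rightarrow> 'v::ab_group_add \<Rightarrow> 'v"
    and Basis :: "'v set"
    and q n r s t :: nat
    and R S :: "nat set"
    and \<A> \<B> :: "'v set set"
  assumes V: "finite_dimensional_vector_space scale Basis"
    and q: "q = CARD('k)"
    and n: "vector_space.dim scale (UNIV :: 'v set) = n"
    and pos: "n > 0" "r > 0" "s > 0" "t > 0"
    and R: "R \<subseteq> {1..n}" "R \<noteq> {}"
    and S: "S \<subseteq> {1..n}" "S \<noteq> {}"
    and t: "t \<le> Min (R \<union> S)"
    and r: "r = Max R"
    and s: "s = Max S"
    and rst: "r + s - t < n"
    and \<A>: "\<A> \<subseteq> subspaces_of_dims scale R"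
    and \<B>: "\<B> \<subseteq> subspaces_of_dims scale S"
    and cross: "nonempty_cross_intersecting scale t \<A> \<B>"
  shows "let bound = max (1 + meet_sum q n t r S) (1 + meet_sum q n t s R);
             star_A = (\<exists>A\<in>subspaces_of_dim scale r. \<A> = {A} \<and>
               \<B> = {B \<in> subspaces_of_dims scale S. vector_space.dim scale (B \<inter> A) \<ge> t});
             star_B = (\<exists>B\<in>subspaces_of_dim scale s. \<B> = {B} \<and>
               \<A> = {A \<in> subspaces_of_dims scale R. vector_space.dim scale (A \<inter> B) \<ge> t})
         in real (card \<A>) + real (card \<B>) \<le> bound
          \<and> (R = S \<longrightarrow>
               (real (card \<A>) + real (card \<B>) = bound \<longleftrightarrow> star_A \<or> star_B))
          \<and> (R \<noteq> S \<and> s\<^sup>2 + r\<^sup>2 + s * r \<le> n \<longrightarrow>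
               (real (card \<A>) + real (card \<B>) = bound \<longleftrightarrow>
                  (Max (sym_diff R S) \<in> S \<and> star_A) \<or>
                  (Max (sym_diff R S) \<in> R \<and> star_B)))"
proof -
  interpret V: finite_field_space scale Basis
    using V by (simp add: finite_field_space_def)
  note dimn = n
  have fin: "finite R" "finite S" using R S finite_subset by blast+
  have tle: "R \<subseteq> {t..}" "S \<subseteq> {t..}" using t fin R S by auto
  have rR: "r \<in> R" and sS: "s \<in> S" using fin R S r s Max_in by blast+
  have tr: "t \<le> r" and ts: "t \<le> s" using rR sS tle by auto
  have rn: "r \<le> n" and sn: "s \<le> n" using rR sS R S by auto
  have small: "r + s < n + t" using rst tr by linarith
  let ?a = "meet_sum q n t r S" and ?b = "meet_sum q n t s R"
  define bound where "bound = max (1 + ?a) (1 + ?b)"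
  define star_A where "star_A \<A> \<B> \<longleftrightarrow> (\<exists>A\<in>subspaces_of_dim scale r. \<A> = {A} \<and> \<B> = V.meeting t S A)"
    for \<A> \<B>
  define star_B where "star_B \<A> \<B> \<longleftrightarrow> (\<exists>B\<in>subspaces_of_dim scale s. \<B> = {B} \<and> \<A> = V.meeting t R B)"
    for \<A> \<B>
  have cA: "real (card (V.meeting t S A)) = ?a" if "A \<in> subspaces_of_dim scale r" for A
    using V.card_meeting[OF fin(2), of A t] that unfolding dimn q
    by (simp add: subspaces_of_dim_def)
  have cB: "real (card (V.meeting t R B)) = ?b" if "B \<in> subspaces_of_dim scale s" for B
    using V.card_meeting[OF fin(1), of B t] that unfolding dimn q
    by (simp add: subspaces_of_dim_def)
  have star_A_card: "real (card \<A>) + real (card \<B>) = 1 + ?a" if "star_A \<A> \<B>" for \<A> \<B>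
    using that cA by (auto simp: star_A_def)
  have star_B_card: "real (card \<A>) + real (card \<B>) = 1 + ?b" if "star_B \<A> \<B>" for \<A> \<B>
    using that cB by (auto simp: star_B_def)
  have opt_star: "star_A \<A> \<B> \<or> star_B \<A> \<B>" if opt: "V.optimal t R S \<A> \<B>" for \<A> \<B>
  proof (cases "card \<A> \<le> card \<B>")
    case True
    show ?thesis
      using V.optimal_is_star[OF opt True] fin R S pos tr ts rn sn small
      unfolding dimn r[symmetric] s[symmetric] star_A_def by blast
  next
    case False
    have "V.optimal t S R \<B> \<A>" using opt V.optimal_sym by blast
    then show ?thesis
      using V.optimal_is_star[of t S R \<B> \<A>] False fin R S pos tr ts rn sn small
      unfolding dimn r[symmetric] s[symmetric] star_B_def by (simp add: add.commute)
  qed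
  have P: "V.cross_pair t R S \<A> \<B>" using \<A> \<B> cross by (simp add: V.cross_pair_def)
  obtain \<A>' \<B>' where opt: "V.optimal t R S \<A>' \<B>'"
    using V.optimal_exists[OF P] by blast
  have le': "card \<A> + card \<B> \<le> card \<A>' + card \<B>'" using opt P by (simp add: V.optimal_def)
  \<comment> \<open>An optimal pair is a star, and each kind of star has one of the two terms of the
    maximum as its size.\<close>
  have bound': "real (card \<A>') + real (card \<B>') \<le> bound"
    using opt_star[OF opt] star_A_card star_B_card by (auto simp: bound_def)
  have le: "real (card \<A>) + real (card \<B>) \<le> bound" using le' bound' by linarith
  \<comment> \<open>A pair that reaches \<open>bound\<close> is at least as large as an optimal one,
    hence optimal and a star.\<close>
  have eqD: "star_A \<A> \<B> \<or> star_B \<A> \<B>" if "real (card \<A>) + real (card \<B>) = bound"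
  proof (rule opt_star)
    have "card \<A>' + card \<B>' \<le> card \<A> + card \<B>" using that bound' by linarith
    then show "V.optimal t R S \<A> \<B>" using P opt by (fastforce simp: V.optimal_def)
  qed
  \<comment> \<open>For \<open>R = S\<close> the two terms of the maximum agree, so both kinds of
    star reach it.\<close>
  have c1: "real (card \<A>) + real (card \<B>) = bound \<longleftrightarrow> star_A \<A> \<B> \<or> star_B \<A> \<B>" if "R = S"
    using eqD star_A_card[of \<A> \<B>] star_B_card[of \<A> \<B>] that r s by (auto simp: bound_def)
  have c2: "real (card \<A>) + real (card \<B>) = bound \<longleftrightarrow>
      (Max (sym_diff R S) \<in> S \<and> star_A \<A> \<B>) \<or> (Max (sym_diff R S) \<in> R \<and> star_B \<A> \<B>)"
    if ne: "R \<noteq> S" and large: "s\<^sup>2 + r\<^sup>2 + s * r \<le> n"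
  proof -
    have rs: "1 \<le> r * r" "1 \<le> s * r" "s \<le> s * s" "1 \<le> s * s" "r \<le> r * r" "s \<le> s * r" "r \<le> s * r"
      using pos by simp_all
    \<comment> \<open>\<open>s\<close> is at most \<open>s * s\<close> and at most
      \<open>s * r\<close>, and likewise for \<open>r\<close>; this gives the half-dimension bound
      behind the doubling of layers.\<close>
    have n2: "2 * s \<le> n" "2 * r \<le> n"
      using large rs unfolding power2_eq_square by linarith+
    obtain A where A: "A \<in> subspaces_of_dim scale r"
      using V.card_subspaces_of_dim_pos[of r] rn unfolding dimn by fastforce
    obtain B where B: "B \<in> subspaces_of_dim scale s"
      using V.card_subspaces_of_dim_pos[of s] sn unfolding dimn by fastforce
    have AB: "V.subspace A" "V.dim A = Max R" "V.subspace B" "V.dim B = Max S"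
      using A B r s by (auto simp: subspaces_of_dim_def)
    \<comment> \<open>The term of \<open>star_A\<close> is then strictly larger, so
      \<open>star_B\<close> cannot reach \<open>bound\<close>; \<open>R_dom\<close> is the mirror
      image.\<close>
    have S_dom: "?b < ?a" if "Max (sym_diff R S) \<in> S"
      using V.card_meeting_less[OF AB fin(1) R(2) tle(1) fin(2) S(2) tle(2) ne that] n2 cA[OF A] cB[OF B]
      unfolding dimn s[symmetric] by linarith
    have R_dom: "?a < ?b" if "Max (sym_diff R S) \<in> R"
      using V.card_meeting_less[OF AB(3,4,1,2) fin(2) S(2) tle(2) fin(1) R(2) tle(1)] that ne n2 cA[OF A] cB[OF B]
      unfolding dimn r[symmetric] by (simp add: Un_commute)
    have "Max (sym_diff R S) \<in> sym_diff R S" using fin ne by (intro Max_in) auto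
    then have "Max (sym_diff R S) \<in> R \<or> Max (sym_diff R S) \<in> S" by blast
    then show ?thesis
      using eqD star_A_card[of \<A> \<B>] star_B_card[of \<A> \<B>] S_dom R_dom by (auto simp: bound_def)
  qed
  show ?thesis
    using le c1 c2
    unfolding Let_def bound_def[symmetric] star_A_def star_B_def V.meeting_def by blast
qed

end
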